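(* Let $f_1$, $f_2$ and $f$ be T-functions on $D$. If the generalized semicommutator $T_{f_1}T_{f_2}-T_f$ has finite rank $N$ on $L_h^2$, then the commutator $[T_{f_1},T_{f_2}]=T_{f_1}T_{f_2}-T_{f_2}T_{f_1}$ also has finite rank on $L_h^2$, and its rank is less than or equal to $2N$.
   Context: $D$ is the open unit disk in $\mathbb{C}$ and $dA$ is Lebesgue area measure on $D$ normalized so that $D$ has measure $1$. $L_h^2$ is the harmonic Bergman space: the closed subspace of $L^2(D,dA)$ consisting of (complex-valued) harmonic functions. $Q$ is the orthogonal projection of $L^2(D,dA)$ onto $L_h^2$, given by $Qf(z)=\int_D\left(\frac{1}{(1-z\bar w)^2}+\frac{1}{(1-\bar z w)^2}-1\right)f(w)\,dA(w)$; the integral formula extends $Q$ to $L^1(D,dA)$. For $u\in L^1(D,dA)$ the operator $h\mapsto Q(uh)$ is densely defined on the harmonic polynomials in $L_h^2$. $u$ is called a T-function if this operator is bounded in the $L_h^2$ norm; then the Toeplitz operator $T_u:L_h^2\to L_h^2$ is its continuous extension. A bounded operator $A$ on a Hilbert space has finite rank if the closure of its range is finite dimensional, and $\mathrm{rank}(A)=\dim \mathrm{Ran}(A)$ (rank $0$ is allowed). *)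

theory Defs
  imports "HOL-Analysis.Analysis" "HOL-Library.Function_Algebras"
begin

abbreviation disc :: "complex set" where
  "disc \<equiv> ball 0 1"

text \<open>Normalized area measure on the disc; its underlying space is the disc itself, so integrals
  and integrability ignore the values of functions off the disc.\<close>

definition dA :: "complex measure" where
  "dA = uniform_measure (lebesgue_on disc) disc"

text \<open>Complex-valued harmonic functions: twice continuously differentiable with vanishing
  Laplacian. Here \<open>hx\<close>, \<open>hy\<close>, \<open>hxx\<close>, \<dots> are the partial derivatives with respect to the real
  coordinates \<open>x = Re z\<close> and \<open>y = Im z\<close>.\<close>

definition harmonic_on :: "complex set \<Rightarrow> (complex \<Rightarrow> complex) \<Rightarrow> bool" where
  "harmonic_on S h \<longleftrightarrow> open S \<and>
    (\<exists>hx hy hxx hxy hyx hyy.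
      (\<forall>z\<in>S. (h has_derivative (\<lambda>v. Re v *\<^sub>R hx z + Im v *\<^sub>R hy z)) (at z) \<and>
             (hx has_derivative (\<lambda>v. Re v *\<^sub>R hxx z + Im v *\<^sub>R hxy z)) (at z) \<and>
             (hy has_derivative (\<lambda>v. Re v *\<^sub>R hyx z + Im v *\<^sub>R hyy z)) (at z) \<and>
             hxx z + hyy z = 0) \<and>
      continuous_on S hxx \<and> continuous_on S hxy \<and> continuous_on S hyx \<and> continuous_on S hyy)"

text \<open>The harmonic Bergman space. Every class in it has exactly one harmonic representative on the
  disc; that representative, extended by \<open>0\<close> off the disc, is used. With this convention distinct
  elements of the set are distinct vectors of the Hilbert space, and the linear structure is the
  pointwise one.\<close>

definition Lh2 :: "(complex \<Rightarrow> complex) set" where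
  "Lh2 = {h. harmonic_on disc h \<and> integrable dA (\<lambda>z. (cmod (h z))\<^sup>2) \<and> (\<forall>z. z \<notin> disc \<longrightarrow> h z = 0)}"

definition norm2 :: "(complex \<Rightarrow> complex) \<Rightarrow> real" where
  "norm2 h = sqrt (LINT z|dA. (cmod (h z))\<^sup>2)"

text \<open>The integral formula for the orthogonal projection, applied to arbitrary integrable
  functions.\<close>

definition Q :: "(complex \<Rightarrow> complex) \<Rightarrow> complex \<Rightarrow> complex" where
  "Q f z = (if z \<in> disc
     then LINT w|dA. (1 / (1 - z * cnj w)\<^sup>2 + 1 / (1 - cnj z * w)\<^sup>2 - 1) * f w
     else 0)"

definition harmonic_polys :: "(complex \<Rightarrow> complex) set" where
  "harmonic_polys = {p \<in> Lh2. \<exists>(n::nat) (c :: nat \<Rightarrow> nat \<Rightarrow> complex). \<forall>z\<in>disc.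
     p z = (\<Sum>j\<le>n. \<Sum>k\<le>n. c j k * of_real (Re z) ^ j * of_real (Im z) ^ k)}"

definition T_function :: "(complex \<Rightarrow> complex) \<Rightarrow> bool" where
  "T_function u \<longleftrightarrow> integrable dA u \<and>
     (\<exists>C. \<forall>p\<in>harmonic_polys.
        Q (\<lambda>w. u w * p w) \<in> Lh2 \<and> norm2 (Q (\<lambda>w. u w * p w)) \<le> C * norm2 p)"

text \<open>The continuous extension of \<open>p \<mapsto> Q (u p)\<close> from the harmonic polynomials to \<open>Lh2\<close>: the value
  at \<open>h\<close> is the common limit of the values along all sequences of harmonic polynomials converging
  to \<open>h\<close>. It is meaningful for T-functions \<open>u\<close> and \<open>h \<in> Lh2\<close> only.\<close>

definition toeplitz :: "(complex \<Rightarrow> complex) \<Rightarrow> (complex \<Rightarrow> complex) \<Rightarrow> (complex \<Rightarrow> complex)" where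
  "toeplitz u h = (THE g. g \<in> Lh2 \<and>
     (\<forall>p. (\<forall>n. p n \<in> harmonic_polys) \<and> (\<lambda>n. norm2 (p n - h)) \<longlonglongrightarrow> 0 \<longrightarrow>
          (\<lambda>n. norm2 (Q (\<lambda>w. u w * p n w) - g)) \<longlonglongrightarrow> 0))"

text \<open>Span and dimension are those of the complex vector space of all functions.\<close>

interpretation cfun: vector_space "\<lambda>(c::complex) (h :: complex \<Rightarrow> complex) z. c * h z"
  by standard (auto simp: fun_eq_iff algebra_simps)

definition Lh2_closure :: "(complex \<Rightarrow> complex) set \<Rightarrow> (complex \<Rightarrow> complex) set" where
  "Lh2_closure X = {g \<in> Lh2. \<forall>e>0. \<exists>h\<in>X. norm2 (h - g) < e}"

definition finite_rank :: "((complex \<Rightarrow> complex) \<Rightarrow> (complex \<Rightarrow> complex)) \<Rightarrow> bool" where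
  "finite_rank A \<longleftrightarrow> (\<exists>B. finite B \<and> Lh2_closure (A ` Lh2) \<subseteq> cfun.span B)"

text \<open>The library's dimension is \<open>0\<close> on infinite-dimensional sets, so this is to be used together
  with \<open>finite_rank\<close>.\<close>

definition op_rank :: "((complex \<Rightarrow> complex) \<Rightarrow> (complex \<Rightarrow> complex)) \<Rightarrow> nat" where
  "op_rank A = cfun.dim (A ` Lh2)"

end

theory Submission
  imports Defs "HOL-Complex_Analysis.Complex_Analysis"
begin

text \<open>
  The reason the theorem holds is that every Toeplitz operator is symmetric for the \<^emph>\<open>bilinear\<close> form
  \<open>bilin g h = \<integral> g h dA\<close>: for harmonic polynomials \<open>p\<close> and \<open>q\<close>,
  both \<open>bilin (Q (u p)) q\<close> and \<open>bilin p (Q (u q))\<close> equal \<open>\<integral> u p q dA\<close>.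
  Hence the operators \<open>A = T\<^sub>1 T\<^sub>2 - T\<close> and \<open>A' = T\<^sub>2 T\<^sub>1 - T\<close>, with \<open>T\<^sub>1\<close>, \<open>T\<^sub>2\<close>, \<open>T\<close> the Toeplitz operators of
  \<open>f1\<close>, \<open>f2\<close>, \<open>f\<close>, are transposes of each other, so \<open>rank A' \<le> rank A = N\<close>. Since the commutator is
  \<open>A - A'\<close>, its rank is at most \<open>2 N\<close>. The two halves of this argument are \<open>toeplitz_symmetric\<close> and
  \<open>range_adjoint_finite_dim\<close>; \<open>finite_dim_closed\<close> passes from the range to its closure.

  The analytic work is to make sense of \<open>T\<^sub>u\<close> and to justify \<open>\<integral> (Q \<psi>) q = \<integral> \<psi> q\<close>, where Fubini is not
  directly available because the kernel of \<open>Q\<close> is unbounded. Everything is reduced to coefficients. A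
  harmonic function on the disc is \<open>F + cnj G\<close> with holomorphic \<open>F\<close> and \<open>G\<close>, hence a series
  \<open>\<Sum> a\<^sub>n z\<^sup>n + b\<^sub>n (cnj z)\<^sup>n\<close>. The terms are orthogonal on every concentric disc, which gives the Parseval
  identity \<open>\<parallel>h\<parallel>\<^sup>2 = \<Sum> (|a\<^sub>n|\<^sup>2 + |b\<^sub>n|\<^sup>2) / (n + 1)\<close> and identifies \<open>Lh2\<close> with a weighted sequence space.
  From this follow the density of harmonic polynomials (truncation), completeness (limits of
  coefficients) and the integrals of an \<open>Lh2\<close> function against \<open>z\<^sup>n\<close> and \<open>(cnj z)\<^sup>n\<close>. Expanding the kernel
  shows that \<open>Q \<psi>\<close> is always such a series, with coefficients \<open>(n + 1) \<integral> (cnj w)\<^sup>n \<psi>\<close> and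
  \<open>(n + 1) \<integral> w\<^sup>n \<psi>\<close>; comparing the two computations gives \<open>\<integral> (Q \<psi>) q = \<integral> \<psi> q\<close> for polynomials \<open>q\<close> of this form
  whenever \<open>Q \<psi>\<close> lies in \<open>Lh2\<close>.
\<close>

section \<open>Harmonic functions as sums of holomorphic and antiholomorphic ones\<close>

text \<open>Two applications of the mean value theorem, one in each direction. Exchanging \<open>e\<close> and \<open>d\<close> leaves
  the second difference unchanged but turns one mixed derivative into the other; this is how the
  equality of mixed partials is obtained.\<close>

lemma second_difference_mean_value:
  fixes g ge ged :: "'a::real_normed_vector \<Rightarrow> real" and z e d :: 'a and t :: real
  assumes t: "0 < t"
    and g: "\<And>r s. \<lbrakk>r \<in> {0..t}; s \<in> {0..t}\<rbrakk> \<Longrightarrow>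
      ((\<lambda>r. g (z + r *\<^sub>R e + s *\<^sub>R d)) has_real_derivative ge (z + r *\<^sub>R e + s *\<^sub>R d)) (at r)"
    and ge: "\<And>r s. \<lbrakk>r \<in> {0..t}; s \<in> {0..t}\<rbrakk> \<Longrightarrow>
      ((\<lambda>s. ge (z + r *\<^sub>R e + s *\<^sub>R d)) has_real_derivative ged (z + r *\<^sub>R e + s *\<^sub>R d)) (at s)"
  shows "\<exists>r s. r \<in> {0..t} \<and> s \<in> {0..t} \<and>
    g (z + t *\<^sub>R e + t *\<^sub>R d) - g (z + t *\<^sub>R e) - g (z + t *\<^sub>R d) + g z
      = t\<^sup>2 * ged (z + r *\<^sub>R e + s *\<^sub>R d)"
proof -
  define \<phi> where "\<phi> r = g (z + r *\<^sub>R e + t *\<^sub>R d) - g (z + r *\<^sub>R e + 0 *\<^sub>R d)" for r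
  have "\<exists>r. 0 < r \<and> r < t \<and>
      \<phi> t - \<phi> 0 = (t - 0) * (ge (z + r *\<^sub>R e + t *\<^sub>R d) - ge (z + r *\<^sub>R e + 0 *\<^sub>R d))"
    by (rule MVT2[OF t]) (unfold \<phi>_def, intro DERIV_diff g, use t in auto)
  then obtain r where r: "0 < r" "r < t"
      "\<phi> t - \<phi> 0 = t * (ge (z + r *\<^sub>R e + t *\<^sub>R d) - ge (z + r *\<^sub>R e + 0 *\<^sub>R d))"
    by auto
  have "\<exists>s. 0 < s \<and> s < t \<and> ge (z + r *\<^sub>R e + t *\<^sub>R d) - ge (z + r *\<^sub>R e + 0 *\<^sub>R d)
      = (t - 0) * ged (z + r *\<^sub>R e + s *\<^sub>R d)"
    by (rule MVT2[OF t]) (intro ge, use r in auto)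
  then obtain s where "0 < s" "s < t"
      "ge (z + r *\<^sub>R e + t *\<^sub>R d) - ge (z + r *\<^sub>R e + 0 *\<^sub>R d)
        = t * ged (z + r *\<^sub>R e + s *\<^sub>R d)"
    by auto
  with r show ?thesis
    by (intro exI[of _ r] exI[of _ s]) (auto simp: \<phi>_def power2_eq_square)
qed

lemma DERIV_along_line:
  fixes g :: "complex \<Rightarrow> real" and z e :: complex
  assumes "(g has_derivative g') (at (z + r *\<^sub>R e))"
  shows "((\<lambda>r. g (z + r *\<^sub>R e)) has_real_derivative g' e) (at r)"
proof -
  have "((\<lambda>r. g (z + r *\<^sub>R e)) has_derivative (\<lambda>h. g' (h *\<^sub>R e))) (at r)"
    by (rule has_derivative_compose[of "\<lambda>r. z + r *\<^sub>R e", OF _ assms])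
       (auto intro!: derivative_eq_intros)
  moreover have "g' (h *\<^sub>R e) = h * g' e" for h
    using has_derivative_linear[OF assms] by (simp add: linear_cmul)
  ultimately show ?thesis
    by (simp add: has_field_derivative_def mult.commute[of _ "g' e"])
qed

lemma mixed_partials_eq:
  fixes g gx gy gxx gxy gyx gyy :: "complex \<Rightarrow> real"
  assumes S: "open S" "z \<in> S"
    and g: "\<And>w. w \<in> S \<Longrightarrow> (g has_derivative (\<lambda>v. Re v * gx w + Im v * gy w)) (at w)"
    and gx: "\<And>w. w \<in> S \<Longrightarrow> (gx has_derivative (\<lambda>v. Re v * gxx w + Im v * gxy w)) (at w)"
    and gy: "\<And>w. w \<in> S \<Longrightarrow> (gy has_derivative (\<lambda>v. Re v * gyx w + Im v * gyy w)) (at w)"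
    and cont: "continuous_on S gxy" "continuous_on S gyx"
  shows "gxy z = gyx z"
proof (rule ccontr)
  assume neq: "gxy z \<noteq> gyx z"
  define \<epsilon> where "\<epsilon> = \<bar>gxy z - gyx z\<bar> / 2"
  have \<epsilon>: "\<epsilon> > 0" using neq by (simp add: \<epsilon>_def)
  have "isCont gxy z" "isCont gyx z"
    using cont S by (auto simp: continuous_on_eq_continuous_at)
  then obtain d1 d2 where d1: "d1 > 0" "\<And>w. dist w z < d1 \<Longrightarrow> dist (gxy w) (gxy z) < \<epsilon>"
    and d2: "d2 > 0" "\<And>w. dist w z < d2 \<Longrightarrow> dist (gyx w) (gyx z) < \<epsilon>"
    using \<epsilon> unfolding continuous_at_eps_delta by metis
  obtain d3 where d3: "d3 > 0" "\<And>w. dist w z < d3 \<Longrightarrow> w \<in> S"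
    using S open_dist by blast
  define t where "t = min d1 (min d2 d3) / 3"
  have t: "t > 0" using d1 d2 d3 by (auto simp: t_def)
  have near: "dist (z + r *\<^sub>R a + s *\<^sub>R b) z < min d1 (min d2 d3)"
    if "r \<in> {0..t}" "s \<in> {0..t}" "norm a = 1" "norm b = 1" for r s and a b :: complex
  proof -
    have "dist (z + r *\<^sub>R a + s *\<^sub>R b) z = norm (r *\<^sub>R a + s *\<^sub>R b)"
      by (simp add: dist_norm add.assoc)
    also have "\<dots> \<le> r + s"
      using norm_triangle_ineq[of "r *\<^sub>R a" "s *\<^sub>R b"] that by simp
    also have "\<dots> < min d1 (min d2 d3)" using that t by (auto simp: t_def)
    finally show ?thesis .
  qed
  have inS: "z + r *\<^sub>R a + s *\<^sub>R b \<in> S"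
    if "r \<in> {0..t}" "s \<in> {0..t}" "norm a = 1" "norm b = 1" for r s and a b :: complex
    using near[OF that] d3 by simp
  have line: "(\<lambda>r. k (z + r *\<^sub>R a + s *\<^sub>R b)) = (\<lambda>r. k ((z + s *\<^sub>R b) + r *\<^sub>R a))"
    for k :: "complex \<Rightarrow> real" and a b s by (simp add: algebra_simps)
  have "\<exists>r s. r \<in> {0..t} \<and> s \<in> {0..t} \<and>
      g (z + t *\<^sub>R 1 + t *\<^sub>R \<i>) - g (z + t *\<^sub>R 1) - g (z + t *\<^sub>R \<i>) + g z
        = t\<^sup>2 * gxy (z + r *\<^sub>R 1 + s *\<^sub>R \<i>)"
  proof (rule second_difference_mean_value[OF t])
    fix r s assume rs: "r \<in> {0..t}" "s \<in> {0..t}"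
    note I = inS[OF rs, of 1 \<i>]
    show "((\<lambda>r. g (z + r *\<^sub>R 1 + s *\<^sub>R \<i>)) has_real_derivative gx (z + r *\<^sub>R 1 + s *\<^sub>R \<i>)) (at r)"
      by (subst line) (use DERIV_along_line[of g _ "z + s *\<^sub>R \<i>" r 1, OF g] I
        in \<open>simp add: algebra_simps\<close>)
    show "((\<lambda>s. gx (z + r *\<^sub>R 1 + s *\<^sub>R \<i>)) has_real_derivative gxy (z + r *\<^sub>R 1 + s *\<^sub>R \<i>)) (at s)"
      using DERIV_along_line[of gx _ "z + r *\<^sub>R 1" s \<i>, OF gx] I
      by (simp add: algebra_simps)
  qed
  then obtain r s where 1: "r \<in> {0..t}" "s \<in> {0..t}"
      "g (z + t *\<^sub>R 1 + t *\<^sub>R \<i>) - g (z + t *\<^sub>R 1) - g (z + t *\<^sub>R \<i>) + g z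
        = t\<^sup>2 * gxy (z + r *\<^sub>R 1 + s *\<^sub>R \<i>)" by blast
  have "\<exists>r s. r \<in> {0..t} \<and> s \<in> {0..t} \<and>
      g (z + t *\<^sub>R \<i> + t *\<^sub>R 1) - g (z + t *\<^sub>R \<i>) - g (z + t *\<^sub>R 1) + g z
        = t\<^sup>2 * gyx (z + r *\<^sub>R \<i> + s *\<^sub>R 1)"
  proof (rule second_difference_mean_value[OF t])
    fix r s assume rs: "r \<in> {0..t}" "s \<in> {0..t}"
    note I = inS[OF rs, of \<i> 1]
    show "((\<lambda>r. g (z + r *\<^sub>R \<i> + s *\<^sub>R 1)) has_real_derivative gy (z + r *\<^sub>R \<i> + s *\<^sub>R 1)) (at r)"
      by (subst line) (use DERIV_along_line[of g _ "z + s *\<^sub>R 1" r \<i>, OF g] I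
        in \<open>simp add: algebra_simps\<close>)
    show "((\<lambda>s. gy (z + r *\<^sub>R \<i> + s *\<^sub>R 1)) has_real_derivative gyx (z + r *\<^sub>R \<i> + s *\<^sub>R 1)) (at s)"
      using DERIV_along_line[of gy _ "z + r *\<^sub>R \<i>" s 1, OF gy] I
      by (simp add: algebra_simps)
  qed
  then obtain r' s' where 2: "r' \<in> {0..t}" "s' \<in> {0..t}"
      "g (z + t *\<^sub>R \<i> + t *\<^sub>R 1) - g (z + t *\<^sub>R \<i>) - g (z + t *\<^sub>R 1) + g z
        = t\<^sup>2 * gyx (z + r' *\<^sub>R \<i> + s' *\<^sub>R 1)" by blast
  have "z + t *\<^sub>R \<i> + t *\<^sub>R 1 = z + t *\<^sub>R 1 + t *\<^sub>R \<i>" by simp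
  then have "t\<^sup>2 * gxy (z + r *\<^sub>R 1 + s *\<^sub>R \<i>) = t\<^sup>2 * gyx (z + r' *\<^sub>R \<i> + s' *\<^sub>R 1)"
    using 1(3) 2(3) by (simp only:)
  then have "gxy (z + r *\<^sub>R 1 + s *\<^sub>R \<i>) = gyx (z + r' *\<^sub>R \<i> + s' *\<^sub>R 1)" using t by simp
  moreover have "dist (gxy (z + r *\<^sub>R 1 + s *\<^sub>R \<i>)) (gxy z) < \<epsilon>"
    using near[OF 1(1,2), of 1 \<i>] by (intro d1(2)) auto
  moreover have "dist (gyx (z + r' *\<^sub>R \<i> + s' *\<^sub>R 1)) (gyx z) < \<epsilon>"
    using near[OF 2(1,2), of \<i> 1] by (intro d2(2)) auto
  ultimately show False unfolding \<epsilon>_def dist_real_def by (simp add: abs_if split: if_splits)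
qed

lemma mixed_partials_eq_complex:
  fixes h hx hy hxx hxy hyx hyy :: "complex \<Rightarrow> complex"
  assumes S: "open S" "z \<in> S"
    and h: "\<And>w. w \<in> S \<Longrightarrow> (h has_derivative (\<lambda>v. Re v *\<^sub>R hx w + Im v *\<^sub>R hy w)) (at w)"
    and hx: "\<And>w. w \<in> S \<Longrightarrow> (hx has_derivative (\<lambda>v. Re v *\<^sub>R hxx w + Im v *\<^sub>R hxy w)) (at w)"
    and hy: "\<And>w. w \<in> S \<Longrightarrow> (hy has_derivative (\<lambda>v. Re v *\<^sub>R hyx w + Im v *\<^sub>R hyy w)) (at w)"
    and cont: "continuous_on S hxy" "continuous_on S hyx"
  shows "hxy z = hyx z"
proof (rule complex_eqI)
  have Re: "((\<lambda>w. Re (f w)) has_derivative (\<lambda>v. Re v * Re (fx w) + Im v * Re (fy w))) (at w)"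
    if "(f has_derivative (\<lambda>v. Re v *\<^sub>R fx w + Im v *\<^sub>R fy w)) (at w)" for f fx fy :: "complex \<Rightarrow> complex" and w
    using bounded_linear.has_derivative[OF bounded_linear_Re that] by simp
  have Im: "((\<lambda>w. Im (f w)) has_derivative (\<lambda>v. Re v * Im (fx w) + Im v * Im (fy w))) (at w)"
    if "(f has_derivative (\<lambda>v. Re v *\<^sub>R fx w + Im v *\<^sub>R fy w)) (at w)" for f fx fy :: "complex \<Rightarrow> complex" and w
    using bounded_linear.has_derivative[OF bounded_linear_Im that] by simp
  show "Re (hxy z) = Re (hyx z)"
    by (rule mixed_partials_eq[OF S, of "\<lambda>w. Re (h w)" "\<lambda>w. Re (hx w)" "\<lambda>w. Re (hy w)"
          "\<lambda>w. Re (hxx w)" "\<lambda>w. Re (hxy w)" "\<lambda>w. Re (hyx w)" "\<lambda>w. Re (hyy w)"])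
       (intro Re h hx hy continuous_intros cont; assumption)+
  show "Im (hxy z) = Im (hyx z)"
    by (rule mixed_partials_eq[OF S, of "\<lambda>w. Im (h w)" "\<lambda>w. Im (hx w)" "\<lambda>w. Im (hy w)"
          "\<lambda>w. Im (hxx w)" "\<lambda>w. Im (hxy w)" "\<lambda>w. Im (hyx w)" "\<lambda>w. Im (hyy w)"])
       (intro Im h hx hy continuous_intros cont; assumption)+
qed

text \<open>The functions \<open>(h\<^sub>x - \<i> h\<^sub>y) / 2\<close> and \<open>cnj ((h\<^sub>x + \<i> h\<^sub>y) / 2)\<close> satisfy the Cauchy--Riemann equations:
  one of them is the vanishing of the Laplacian, the other the symmetry of the mixed partials. Their
  primitives are \<open>F\<close> and \<open>G\<close>, up to an additive constant.\<close>

lemma harmonic_on_disc_decompose: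
  assumes "harmonic_on disc h"
  obtains F G where "F holomorphic_on disc" "G holomorphic_on disc" "G 0 = 0"
    "\<And>z. z \<in> disc \<Longrightarrow> h z = F z + cnj (G z)"
proof -
  obtain hx hy hxx hxy hyx hyy where
    *: "\<forall>z\<in>disc. (h has_derivative (\<lambda>v. Re v *\<^sub>R hx z + Im v *\<^sub>R hy z)) (at z) \<and>
             (hx has_derivative (\<lambda>v. Re v *\<^sub>R hxx z + Im v *\<^sub>R hxy z)) (at z) \<and>
             (hy has_derivative (\<lambda>v. Re v *\<^sub>R hyx z + Im v *\<^sub>R hyy z)) (at z) \<and>
             hxx z + hyy z = 0"
    and cont: "continuous_on disc hxy" "continuous_on disc hyx"
    using assms unfolding harmonic_on_def by (elim conjE exE)
  have h: "(h has_derivative (\<lambda>v. Re v *\<^sub>R hx z + Im v *\<^sub>R hy z)) (at z)"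
    and hx: "(hx has_derivative (\<lambda>v. Re v *\<^sub>R hxx z + Im v *\<^sub>R hxy z)) (at z)"
    and hy: "(hy has_derivative (\<lambda>v. Re v *\<^sub>R hyx z + Im v *\<^sub>R hyy z)) (at z)"
    and lap: "hxx z + hyy z = 0" if "z \<in> disc" for z
    using bspec[OF * that] by blast+
  have sym: "hxy z = hyx z" if "z \<in> disc" for z
    by (rule mixed_partials_eq_complex[OF _ that h hx hy cont]) auto
  have lap': "hyy z = - hxx z" if "z \<in> disc" for z
    using lap[OF that] by (simp add: eq_neg_iff_add_eq_0 add.commute)
  define p where "p = (\<lambda>z. (hx z - \<i> * hy z) / 2)"
  define q where "q = (\<lambda>z. (cnj (hx z) - \<i> * cnj (hy z)) / 2)"
  have p': "(p has_field_derivative (hxx z - \<i> * hyx z) / 2) (at z)" if z: "z \<in> disc" for z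
    unfolding has_field_derivative_def p_def
    by (rule derivative_eq_intros hx[OF z] hy[OF z] refl | simp)+
       (auto simp: fun_eq_iff sym[OF z] lap'[OF z] complex_eq_iff algebra_simps)
  have q': "(q has_field_derivative (cnj (hxx z) - \<i> * cnj (hyx z)) / 2) (at z)" if z: "z \<in> disc" for z
    unfolding has_field_derivative_def q_def
    by (rule derivative_eq_intros hx[OF z] hy[OF z] refl bounded_linear.has_derivative[OF bounded_linear_cnj] | simp)+
       (auto simp: fun_eq_iff sym[OF z] lap'[OF z] complex_eq_iff algebra_simps)
  have "p holomorphic_on disc" "q holomorphic_on disc"
    using p' q' by (auto simp: holomorphic_on_open field_differentiable_def intro!: exI)
  then obtain F G where F: "\<And>z. z \<in> disc \<Longrightarrow> (F has_field_derivative p z) (at z within disc)"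
    and G: "\<And>z. z \<in> disc \<Longrightarrow> (G has_field_derivative q z) (at z within disc)"
    using holomorphic_convex_primitive'[of disc] by (metis convex_ball open_ball)
  have F': "(F has_derivative (\<lambda>v. p z * v)) (at z)" and G': "(G has_derivative (\<lambda>v. q z * v)) (at z)"
    if "z \<in> disc" for z
    using F[OF that] G[OF that] that by (auto simp: at_within_open[of z disc] has_field_derivative_def)
  have "\<exists>c. \<forall>z\<in>disc. h z - F z - cnj (G z) = c"
  proof (rule has_derivative_zero_constant)
    fix z assume z: "z \<in> disc"
    have "((\<lambda>z. h z - F z - cnj (G z)) has_derivative (\<lambda>v. 0)) (at z)"
      by (rule derivative_eq_intros h[OF z] F'[OF z] G'[OF z] refl bounded_linear.has_derivative[OF bounded_linear_cnj] | simp)+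
         (auto simp: fun_eq_iff p_def q_def complex_eq_iff field_simps)
    then show "((\<lambda>z. h z - F z - cnj (G z)) has_derivative (\<lambda>v. 0)) (at z within disc)"
      by (rule has_derivative_at_withinI)
  qed auto
  then obtain c where c: "\<And>z. z \<in> disc \<Longrightarrow> h z - F z - cnj (G z) = c" by blast
  have hol: "F holomorphic_on disc" "G holomorphic_on disc"
    using F G unfolding holomorphic_on_def field_differentiable_def by blast+
  show ?thesis
  proof
    show "(\<lambda>z. F z + (c + cnj (G 0))) holomorphic_on disc" "(\<lambda>z. G z - G 0) holomorphic_on disc"
      by (auto intro!: holomorphic_intros hol)
  qed (use c in \<open>auto simp: algebra_simps\<close>)
qed

lemma harmonic_on_disc_holomorphic_add_cnj:
  assumes F: "F holomorphic_on disc" and G: "G holomorphic_on disc"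
    and h: "\<And>z. z \<in> disc \<Longrightarrow> h z = F z + cnj (G z)"
  shows "harmonic_on disc h"
proof -
  define F1 F2 G1 G2 where "F1 = deriv F" and "F2 = deriv F1" and "G1 = deriv G" and "G2 = deriv G1"
  have hol: "F1 holomorphic_on disc" "F2 holomorphic_on disc" "G1 holomorphic_on disc" "G2 holomorphic_on disc"
    unfolding F1_def F2_def G1_def G2_def by (auto intro!: holomorphic_deriv F G)
  have D: "(F has_derivative (\<lambda>v. F1 z * v)) (at z)" "(F1 has_derivative (\<lambda>v. F2 z * v)) (at z)"
    "(G has_derivative (\<lambda>v. G1 z * v)) (at z)" "(G1 has_derivative (\<lambda>v. G2 z * v)) (at z)" if "z \<in> disc" for z
    using holomorphic_derivI[OF F open_ball that] holomorphic_derivI[OF hol(1) open_ball that]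
      holomorphic_derivI[OF G open_ball that] holomorphic_derivI[OF hol(3) open_ball that]
    by (auto simp: F1_def F2_def G1_def G2_def has_field_derivative_def)
  note cn = bounded_linear.has_derivative[OF bounded_linear_cnj]
  have h': "(h has_derivative (\<lambda>v. Re v *\<^sub>R (F1 z + cnj (G1 z)) + Im v *\<^sub>R (\<i> * F1 z - \<i> * cnj (G1 z)))) (at z)"
    if z: "z \<in> disc" for z
  proof (rule has_derivative_transform_within_open[OF _ open_ball z])
    show "((\<lambda>z. F z + cnj (G z)) has_derivative
       (\<lambda>v. Re v *\<^sub>R (F1 z + cnj (G1 z)) + Im v *\<^sub>R (\<i> * F1 z - \<i> * cnj (G1 z)))) (at z)"
      by (rule derivative_eq_intros D(1,3)[OF z] refl cn | simp)+
         (auto simp: fun_eq_iff complex_eq_iff algebra_simps)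
  qed (simp add: h)
  have hx': "((\<lambda>z. F1 z + cnj (G1 z)) has_derivative
      (\<lambda>v. Re v *\<^sub>R (F2 z + cnj (G2 z)) + Im v *\<^sub>R (\<i> * F2 z - \<i> * cnj (G2 z)))) (at z)" if z: "z \<in> disc" for z
    by (rule derivative_eq_intros D(2,4)[OF z] refl cn | simp)+
       (auto simp: fun_eq_iff complex_eq_iff algebra_simps)
  have hy': "((\<lambda>z. \<i> * F1 z - \<i> * cnj (G1 z)) has_derivative
      (\<lambda>v. Re v *\<^sub>R (\<i> * F2 z - \<i> * cnj (G2 z)) + Im v *\<^sub>R (- F2 z - cnj (G2 z)))) (at z)" if z: "z \<in> disc" for z
    by (rule derivative_eq_intros D(2,4)[OF z] refl cn | simp)+
       (auto simp: fun_eq_iff complex_eq_iff algebra_simps)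
  have c: "continuous_on disc F2" "continuous_on disc G2"
    using hol holomorphic_on_imp_continuous_on by blast+
  show ?thesis unfolding harmonic_on_def
    using h' hx' hy' by (intro conjI open_ball exI ballI) (auto intro!: continuous_intros c)
qed


section \<open>Area measure on the disc\<close>

lemma prod_Basis_real2: "(\<Prod>b\<in>Basis. (v::real^2) \<bullet> b) = v $ 1 * v $ 2"
proof -
  have B: "(Basis :: (real^2) set) = {axis 1 1, axis 2 1}"
    by (auto simp: Basis_vec_def UNIV_2)
  have "axis 1 1 \<noteq> (axis 2 1 :: real^2)" by (simp add: axis_eq_axis)
  then show ?thesis unfolding B by (simp add: inner_axis)
qed

lemma mem_box_real2: "v \<in> box (l::real^2) u \<longleftrightarrow> l$1 < v$1 \<and> v$1 < u$1 \<and> l$2 < v$2 \<and> v$2 < u$2"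
  by (auto simp: mem_box_cart forall_2)

text \<open>Multiplication by a unimodular number is an orthogonal transformation of the real plane; this
  identification carries the invariance of Lebesgue measure over to the complex numbers.\<close>

definition complex_of_vec :: "real^2 \<Rightarrow> complex" where
  "complex_of_vec v = Complex (v $ 1) (v $ 2)"

definition vec_of_complex :: "complex \<Rightarrow> real^2" where
  "vec_of_complex z = vector [Re z, Im z]"

lemma complex_of_vec_of_complex [simp]: "complex_of_vec (vec_of_complex z) = z"
  by (simp add: complex_of_vec_def vec_of_complex_def)

lemma vec_of_complex_of_vec [simp]: "vec_of_complex (complex_of_vec v) = v"
  by (simp add: complex_of_vec_def vec_of_complex_def vec_eq_iff forall_2)

lemma borel_measurable_complex_of_vec [measurable]: "complex_of_vec \<in> borel_measurable borel"
  unfolding complex_of_vec_def Complex_eq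
  by (intro borel_measurable_continuous_onI continuous_intros)

lemma vimage_complex_of_vec_box:
  "complex_of_vec -` box l u = box (vec_of_complex l) (vec_of_complex u)"
  by (auto simp: complex_of_vec_def vec_of_complex_def mem_box_real2 in_box_complex_iff)

lemma lborel_eq_distr_complex_of_vec: "lborel = distr lborel borel complex_of_vec"
proof (rule lborel_eqI)
  fix l u :: complex
  assume le: "\<And>b. b \<in> Basis \<Longrightarrow> l \<bullet> b \<le> u \<bullet> b"
  have le': "Re l \<le> Re u" "Im l \<le> Im u"
    using le[of 1] le[of \<i>] by (auto simp: Basis_complex_def)
  have "emeasure (distr lborel borel complex_of_vec) (box l u)
      = emeasure lborel (box (vec_of_complex l) (vec_of_complex u))"
    by (subst emeasure_distr) (auto simp: vimage_complex_of_vec_box)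
  also have "\<dots> = ennreal (\<Prod>b\<in>Basis. (vec_of_complex u - vec_of_complex l) \<bullet> b)"
  proof (subst emeasure_lborel_box)
    fix b :: "real^2" assume "b \<in> Basis"
    then have "b = axis 1 1 \<or> b = axis 2 1" by (auto simp: Basis_vec_def UNIV_2)
    then show "vec_of_complex l \<bullet> b \<le> vec_of_complex u \<bullet> b"
      using le' by (auto simp: inner_axis vec_of_complex_def)
  qed auto
  also have "(\<Prod>b\<in>Basis. (vec_of_complex u - vec_of_complex l) \<bullet> b) = (\<Prod>b\<in>Basis. (u - l) \<bullet> b)"
    unfolding prod_Basis_real2 by (simp add: vec_of_complex_def Basis_complex_def)
  finally show "emeasure (distr lborel borel complex_of_vec) (box l u) = ennreal (\<Prod>b\<in>Basis. (u - l) \<bullet> b)" .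
qed simp

lemma distr_lborel_rotation:
  assumes c: "cmod c = 1"
  shows "distr lborel borel ((*) c) = (lborel :: complex measure)"
proof (rule lborel_eqI[symmetric])
  fix l u :: complex
  assume le: "\<And>b. b \<in> Basis \<Longrightarrow> l \<bullet> b \<le> u \<bullet> b"
  define R where "R v = vec_of_complex (cnj c * complex_of_vec v)" for v
  have cc: "c * cnj c = 1" "cnj c * c = 1"
    using c by (simp_all add: complex_norm_square[symmetric] mult.commute[of "cnj c"])
  have c2: "(Re c)\<^sup>2 + (Im c)\<^sup>2 = 1" using c by (simp add: cmod_def)
  have orth: "orthogonal_transformation R"
    unfolding orthogonal_transformation_def
  proof (intro conjI allI)
    show "linear R"
      by (rule linearI)
         (auto simp: R_def vec_of_complex_def complex_of_vec_def vec_eq_iff forall_2 algebra_simps)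
    fix v w
    have "R v \<bullet> R w = ((Re c)\<^sup>2 + (Im c)\<^sup>2) * (v $ 1 * w $ 1 + v $ 2 * w $ 2)"
      by (simp add: R_def vec_of_complex_def complex_of_vec_def inner_vec_def sum_2 power2_eq_square algebra_simps)
    then show "R v \<bullet> R w = v \<bullet> w"
      by (simp add: c2 inner_vec_def sum_2)
  qed
  define B where "B = box (vec_of_complex l) (vec_of_complex u)"
  have pre: "complex_of_vec -` ((*) c -` box l u) = R ` B"
  proof (intro set_eqI iffI)
    fix v assume v: "v \<in> complex_of_vec -` ((*) c -` box l u)"
    show "v \<in> R ` B"
    proof (rule image_eqI[where x = "vec_of_complex (c * complex_of_vec v)"])
      show "v = R (vec_of_complex (c * complex_of_vec v))"
        by (simp add: R_def cc mult.assoc[symmetric])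
      show "vec_of_complex (c * complex_of_vec v) \<in> B"
        unfolding B_def vimage_complex_of_vec_box[symmetric] using v by simp
    qed
  next
    fix v assume "v \<in> R ` B"
    then obtain w where "v = R w" "w \<in> complex_of_vec -` box l u"
      unfolding B_def vimage_complex_of_vec_box by auto
    then show "v \<in> complex_of_vec -` ((*) c -` box l u)"
      by (simp add: R_def cc mult.assoc[symmetric])
  qed
  have m: "(*) c -` box l u \<in> sets borel"
    using measurable_sets[of "(*) c" borel borel "box l u"] by simp
  have m2: "R ` B \<in> sets borel"
    using measurable_sets[OF borel_measurable_complex_of_vec m] by (simp add: pre)
  have B: "B \<in> lmeasurable" unfolding B_def by (rule lmeasurable_box)
  have "emeasure (distr lborel borel ((*) c)) (box l u) = emeasure lborel ((*) c -` box l u)"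
    by (subst emeasure_distr) auto
  also have "\<dots> = emeasure lborel (R ` B)"
    by (subst lborel_eq_distr_complex_of_vec, subst emeasure_distr) (auto simp: m pre)
  also have "\<dots> = emeasure lebesgue (R ` B)" using m2 by simp
  also have "\<dots> = ennreal (measure lebesgue (R ` B))"
    using measurable_orthogonal_image[OF orth B] by (simp add: emeasure_eq_measure2)
  also have "\<dots> = ennreal (measure lebesgue B)"
    by (simp add: measure_orthogonal_image[OF orth B])
  also have "\<dots> = emeasure lebesgue B"
    using B by (simp add: emeasure_eq_measure2)
  also have "\<dots> = emeasure lborel B" by (simp add: B_def)
  also have "\<dots> = emeasure lborel (box l u)"
    by (subst lborel_eq_distr_complex_of_vec, subst emeasure_distr)
       (auto simp: vimage_complex_of_vec_box B_def)
  also have "\<dots> = ennreal (\<Prod>b\<in>Basis. (u - l) \<bullet> b)" by (rule emeasure_lborel_box[OF le])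
  finally show "emeasure (distr lborel borel ((*) c)) (box l u) = ennreal (\<Prod>b\<in>Basis. (u - l) \<bullet> b)" .
qed simp

lemma space_dA [simp]: "space dA = disc"
  by (simp add: dA_def)

lemma sets_dA: "sets dA = sets (lebesgue_on disc)"
  by (simp add: dA_def)

lemma emeasure_lebesgue_on_disc: "emeasure (lebesgue_on disc) disc = ennreal pi"
proof -
  have "emeasure (lebesgue_on disc) disc = emeasure lebesgue disc"
    by (subst emeasure_restrict_space) auto
  also have "\<dots> = ennreal pi" using emeasure_ball[of 1 "0::complex"] by (simp add: unit_ball_vol_2)
  finally show ?thesis .
qed

lemma emeasure_dA_disc [simp]: "emeasure dA disc = 1"
  unfolding dA_def
  by (rule emeasure_uniform_measure_1) (simp_all add: emeasure_lebesgue_on_disc)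

interpretation dA: finite_measure dA
  by standard simp

lemma measure_dA_disc [simp]: "measure dA disc = 1"
  by (simp add: measure_def)

lemma borel_measurable_dA_continuous:
  fixes f :: "complex \<Rightarrow> 'a::euclidean_space"
  assumes "continuous_on disc f"
  shows "f \<in> borel_measurable dA"
proof -
  have "f \<in> borel_measurable (lebesgue_on disc)"
    by (rule continuous_imp_measurable_on_sets_lebesgue[OF assms]) auto
  then show ?thesis by (simp add: measurable_cong_sets[OF sets_dA refl])
qed

lemma dA_eq_density: "dA = density (lebesgue_on disc) (\<lambda>_. ennreal (1 / pi))"
proof -
  have eq: "indicator disc x / emeasure (lebesgue_on disc) disc = ennreal (1 / pi)"
    if "x \<in> space (lebesgue_on disc)" for x
    using that by (simp add: emeasure_lebesgue_on_disc divide_ennreal_def inverse_ennreal inverse_eq_divide)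
  have "(\<lambda>x. indicator disc x / emeasure (lebesgue_on disc) disc) \<in> borel_measurable (lebesgue_on disc)"
    by (subst measurable_cong[OF eq]) auto
  then show ?thesis
    unfolding dA_def uniform_measure_def by (intro density_cong AE_I2 eq) auto
qed

lemma integral_dA_lborel:
  fixes f :: "complex \<Rightarrow> 'a::euclidean_space"
  assumes "f \<in> borel_measurable borel"
  shows "(LINT z|dA. f z) = (1 / pi) *\<^sub>R (LINT z|lborel. indicator disc z *\<^sub>R f z)"
proof -
  have m: "f \<in> borel_measurable lebesgue"
    using assms by (simp add: measurable_completion)
  then have m1: "f \<in> borel_measurable (lebesgue_on disc)"
    by (rule measurable_restrict_space1)
  have "(LINT z|dA. f z) = (LINT z|lebesgue_on disc. (1 / pi) *\<^sub>R f z)"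
    unfolding dA_eq_density by (rule integral_density[OF m1]) auto
  also have "\<dots> = (1 / pi) *\<^sub>R (LINT z|lebesgue_on disc. f z)" by simp
  also have "(LINT z|lebesgue_on disc. f z) = (LINT z|lebesgue. indicator disc z *\<^sub>R f z)"
    by (rule integral_restrict_space) auto
  also have "\<dots> = (LINT z|lborel. indicator disc z *\<^sub>R f z)"
    using assms by (intro integral_completion) (auto intro!: borel_measurable_scaleR borel_measurable_indicator)
  finally show ?thesis .
qed

lemma integral_dA_rotation:
  fixes f :: "complex \<Rightarrow> 'a::euclidean_space"
  assumes f: "f \<in> borel_measurable borel" and c: "cmod c = 1"
  shows "(LINT z|dA. f (c * z)) = (LINT z|dA. f z)"
proof -
  have m: "(\<lambda>z. f (c * z)) \<in> borel_measurable borel"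
    by (rule measurable_compose[OF _ f]) simp
  have "(LINT z|lborel. indicator disc z *\<^sub>R f z) = (LINT z|distr lborel borel ((*) c). indicator disc z *\<^sub>R f z)"
    by (simp add: distr_lborel_rotation[OF c])
  also have "\<dots> = (LINT z|lborel. indicator disc (c * z) *\<^sub>R f (c * z))"
    using f by (intro integral_distr) (auto intro!: borel_measurable_scaleR borel_measurable_indicator)
  also have "\<dots> = (LINT z|lborel. indicator disc z *\<^sub>R f (c * z))"
    by (simp add: indicator_def norm_mult c)
  finally show ?thesis using f m by (simp add: integral_dA_lborel)
qed

lemma measure_dA_cball:
  assumes "0 \<le> r" "r < 1"
  shows "measure dA (cball 0 r) = r\<^sup>2"
proof -
  have sub: "cball 0 r \<subseteq> disc" using assms by auto
  have "measure dA (cball 0 r) = measure (lebesgue_on disc) (disc \<inter> cball 0 r) / measure (lebesgue_on disc) disc"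
    unfolding dA_def using sub
    by (intro measure_uniform_measure) (auto simp: emeasure_lebesgue_on_disc sets_restrict_space)
  also have "disc \<inter> cball 0 r = cball 0 r" using sub by auto
  also have "measure (lebesgue_on disc) (cball 0 r) = measure lebesgue (cball (0::complex) r)"
    using sub by (intro measure_restrict_space) auto
  also have "\<dots> = pi * r\<^sup>2" using content_cball[of r "0::complex"] assms by (simp add: unit_ball_vol_2)
  also have "measure (lebesgue_on disc) disc = pi"
    using emeasure_lebesgue_on_disc by (simp add: measure_def)
  finally show ?thesis by simp
qed

text \<open>The disc of radius \<open>sqrt x\<close> has measure \<open>x\<close>, so the squared modulus is uniformly distributed. This
  stands in for polar coordinates: it turns radial integrals into integrals over the unit interval.\<close>

lemma distr_dA_cmod_square:
  "distr dA borel (\<lambda>z. (cmod z)\<^sup>2) = uniform_measure lborel {0..1}"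
proof (rule measure_eqI_lessThan)
  have m: "(\<lambda>z. (cmod z)\<^sup>2) \<in> borel_measurable dA"
    by (intro borel_measurable_dA_continuous continuous_intros)
  interpret D: finite_measure "distr dA borel (\<lambda>z. (cmod z)\<^sup>2)"
    by (rule dA.finite_measure_distr[OF m])
  show "emeasure (distr dA borel (\<lambda>z. (cmod z)\<^sup>2)) {x<..} < \<infinity>" for x
    by (simp add: less_top[symmetric])
  show "emeasure (distr dA borel (\<lambda>z. (cmod z)\<^sup>2)) {x<..} = emeasure (uniform_measure lborel {0..1}) {x<..}" for x
  proof -
    have R: "emeasure (uniform_measure lborel {0..1}) {x<..} = emeasure lborel ({0..1} \<inter> {x<..})"
      by (simp add: emeasure_uniform_measure divide_ennreal_def)
    have L: "emeasure (distr dA borel (\<lambda>z. (cmod z)\<^sup>2)) {x<..} = emeasure dA ((\<lambda>z. (cmod z)\<^sup>2) -` {x<..} \<inter> disc)"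
      by (subst emeasure_distr[OF m]) auto
    consider "x < 0" | "0 \<le> x" "x < 1" | "1 \<le> x" by linarith
    then show ?thesis
    proof cases
      case 1
      then have "{0..1} \<inter> {x<..} = {0..1}" "(\<lambda>z. (cmod z)\<^sup>2) -` {x<..} \<inter> disc = space dA"
        by (auto intro: less_le_trans[OF _ zero_le_power2])
      then show ?thesis unfolding L R by simp
    next
      case 2
      have "(\<lambda>z. (cmod z)\<^sup>2) -` {x<..} \<inter> disc = space dA - cball 0 (sqrt x)"
      proof -
        have "cmod z \<le> sqrt x \<longleftrightarrow> (cmod z)\<^sup>2 \<le> x" for z
          using 2 power2_le_iff_abs_le[of "sqrt x" "cmod z"] by simp
        then show ?thesis by (auto simp: not_le[symmetric])
      qed
      moreover have "cball 0 (sqrt x) \<in> sets dA"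
      proof -
        have "sqrt x < 1" using 2 real_sqrt_less_iff[of x 1] by simp
        then have "cball (0::complex) (sqrt x) \<subseteq> disc"
          by (simp add: cball_subset_ball_iff del: real_sqrt_lt_1_iff)
        then show ?thesis unfolding sets_dA by (simp add: sets_restrict_space_iff)
      qed
      ultimately have "emeasure dA ((\<lambda>z. (cmod z)\<^sup>2) -` {x<..} \<inter> disc) = ennreal (1 - measure dA (cball 0 (sqrt x)))"
        using dA.finite_measure_compl[of "cball 0 (sqrt x)"] by (simp add: dA.emeasure_eq_measure)
      also have "\<dots> = ennreal (1 - x)"
        using 2 measure_dA_cball[of "sqrt x"] real_sqrt_less_iff[of x 1] by simp
      also have "\<dots> = emeasure lborel {x<..1}" using 2 by simp
      also have "{x<..1} = {0..1} \<inter> {x<..}" using 2 by auto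
      finally show ?thesis unfolding L R .
    next
      case 3
      have "(cmod z)\<^sup>2 \<le> x" if "cmod z < 1" for z
        using 3 that power_le_one[of "cmod z" 2] by force
      then have "{0..1} \<inter> {x<..} = {}" "(\<lambda>z. (cmod z)\<^sup>2) -` {x<..} \<inter> disc = {}"
        using 3 by (auto simp: not_le[symmetric])
      then show ?thesis unfolding L R by simp
    qed
  qed
qed auto

lemma integral_cmod_power_cball:
  assumes r: "0 \<le> r" "r < 1"
  shows "(LINT z|dA. indicat_real (cball 0 r) z * cmod z ^ (2 * n)) = r ^ (2 * n + 2) / (real n + 1)"
proof -
  define g :: "real \<Rightarrow> real" where "g t = indicator {..r\<^sup>2} t * t ^ n" for t
  have m: "(\<lambda>z. (cmod z)\<^sup>2) \<in> borel_measurable dA"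
    by (intro borel_measurable_dA_continuous continuous_intros)
  have mg: "g \<in> borel_measurable borel" unfolding g_def by measurable
  have "(LINT z|dA. indicat_real (cball 0 r) z * cmod z ^ (2 * n)) = (LINT z|dA. g ((cmod z)\<^sup>2))"
  proof (rule Bochner_Integration.integral_cong[OF refl])
    fix z
    have "cmod z \<le> r \<longleftrightarrow> (cmod z)\<^sup>2 \<le> r\<^sup>2" using r by (simp add: power2_le_iff_abs_le)
    then show "indicat_real (cball 0 r) z * cmod z ^ (2 * n) = g ((cmod z)\<^sup>2)"
      by (auto simp: g_def indicator_def power_mult)
  qed
  also have "\<dots> = (LINT t|uniform_measure lborel {0..1}. g t)"
    unfolding distr_dA_cmod_square[symmetric] by (rule integral_distr[symmetric, OF m]) (simp add: mg)
  also have "uniform_measure lborel {0..1::real} = density lborel (\<lambda>t. ennreal (indicator {0..1} t))"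
    unfolding uniform_measure_def by (rule density_cong) (auto simp: divide_ennreal_def split: split_indicator)
  also have "(LINT t|density lborel (\<lambda>t. ennreal (indicator {0..1} t)). g t) = (LINT t|lborel. indicator {0..1} t *\<^sub>R g t)"
    by (rule integral_density) (use mg in auto)
  also have "\<dots> = (LINT t|lborel. t ^ n * indicator {0..r\<^sup>2} t)"
  proof (rule Bochner_Integration.integral_cong[OF refl])
    fix t :: real
    have "r\<^sup>2 \<le> 1" using r by (simp add: power_le_one)
    then show "indicator {0..1} t *\<^sub>R g t = t ^ n * indicator {0..r\<^sup>2} t"
      by (auto simp: g_def split: split_indicator)
  qed
  also have "\<dots> = ((r\<^sup>2) ^ Suc n - 0 ^ Suc n) / Suc n"
    by (rule integral_power) simp
  also have "\<dots> = r ^ (2 * n + 2) / (real n + 1)"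
    by (simp add: add.commute power_add power_mult power2_eq_square)
  finally show ?thesis .
qed

text \<open>If \<open>n \<noteq> m\<close>, a rotation by a suitable angle changes the sign of the integrand while preserving the
  measure. Discs of radius \<open>r < 1\<close> are used because the series of a harmonic function need not
  converge uniformly on the whole disc.\<close>

lemma integral_monomial_cball:
  assumes r: "0 \<le> r" "r < 1"
  shows "(LINT z|dA. indicat_real (cball 0 r) z *\<^sub>R (z ^ n * cnj z ^ m))
    = (if n = m then complex_of_real (r ^ (2 * n + 2) / (real n + 1)) else 0)"
proof (cases "n = m")
  case True
  have "(\<lambda>z. indicat_real (cball 0 r) z *\<^sub>R (z ^ n * cnj z ^ m))
      = (\<lambda>z. complex_of_real (indicat_real (cball 0 r) z * cmod z ^ (2 * n)))"
    by (auto simp: True fun_eq_iff power_mult power_mult_distrib[symmetric] complex_norm_square[symmetric] scaleR_conv_of_real)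
  then show ?thesis
    using integral_cmod_power_cball[OF r, of n] True by (simp only: integral_complex_of_real) simp
next
  case False
  define f where "f z = indicat_real (cball 0 r) z *\<^sub>R (z ^ n * cnj z ^ m)" for z
  \<comment> \<open>the angle for which \<open>z ^ n * cnj z ^ m\<close> picks up the factor \<open>cis pi = - 1\<close>\<close>
  define c where "c = cis (pi / (real n - real m))"
  have mf: "f \<in> borel_measurable borel"
    unfolding f_def
    by (intro borel_measurable_scaleR borel_measurable_indicator borel_measurable_continuous_onI continuous_intros) auto
  have "c ^ n * cnj c ^ m = cis (pi * (real n - real m) / (real n - real m))"
    by (simp add: c_def Complex.DeMoivre cis_cnj cis_mult diff_divide_distrib algebra_simps)
  also have "\<dots> = -1" using False by simp
  finally have cn: "c ^ n * cnj c ^ m = -1" .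
  have "f (c * z) = - f z" for z
  proof -
    have "f (c * z) = (c ^ n * cnj c ^ m) * f z"
      by (simp add: f_def c_def norm_mult power_mult_distrib indicator_def)
    then show ?thesis by (simp add: cn)
  qed
  then have "(LINT z|dA. f z) = - (LINT z|dA. f z)"
    using integral_dA_rotation[OF mf, of c] by (simp add: c_def)
  then have "(LINT z|dA. f z) = 0" by simp
  then show ?thesis using False by (simp add: f_def)
qed


section \<open>Series expansion and the Parseval identity\<close>

definition hterm :: "(nat \<Rightarrow> complex) \<Rightarrow> (nat \<Rightarrow> complex) \<Rightarrow> nat \<Rightarrow> complex \<Rightarrow> complex" where
  "hterm a b n z = a n * z ^ n + b n * cnj z ^ n"

text \<open>The square of the norm of \<open>hterm a b n\<close> on the unit disc, provided that \<open>b 0 = 0\<close>.\<close>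

definition weight :: "(nat \<Rightarrow> complex) \<Rightarrow> (nat \<Rightarrow> complex) \<Rightarrow> nat \<Rightarrow> real" where
  "weight a b n = ((cmod (a n))\<^sup>2 + (cmod (b n))\<^sup>2) / (real n + 1)"

text \<open>The constants \<open>z ^ 0\<close> and \<open>cnj z ^ 0\<close> coincide; the normalization \<open>b 0 = 0\<close> makes the coefficients
  unique and removes the mixed product of \<open>a 0\<close> and \<open>b 0\<close> from the norm of the constant term.\<close>

definition harm_series :: "(complex \<Rightarrow> complex) \<Rightarrow> (nat \<Rightarrow> complex) \<Rightarrow> (nat \<Rightarrow> complex) \<Rightarrow> bool" where
  "harm_series h a b \<longleftrightarrow> b 0 = 0 \<and>
    (\<forall>z\<in>disc. summable (\<lambda>n. a n * z ^ n) \<and> summable (\<lambda>n. b n * cnj z ^ n) \<and>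
       (\<lambda>n. hterm a b n z) sums h z)"

lemma weight_nonneg [simp]: "weight a b n \<ge> 0"
  by (simp add: weight_def)

lemma harmonic_on_disc_imp_series:
  assumes "harmonic_on disc h"
  obtains a b where "harm_series h a b"
proof -
  obtain F G where F: "F holomorphic_on disc" and G: "G holomorphic_on disc" "G 0 = 0"
    and h: "\<And>z. z \<in> disc \<Longrightarrow> h z = F z + cnj (G z)"
    using harmonic_on_disc_decompose[OF assms] by metis
  define a where "a n = (deriv ^^ n) F 0 / fact n" for n
  define b where "b n = cnj ((deriv ^^ n) G 0 / fact n)" for n
  have A: "(\<lambda>n. a n * z ^ n) sums F z" if "z \<in> disc" for z
    using holomorphic_power_series[OF F that] by (simp add: a_def)
  have B: "(\<lambda>n. b n * cnj z ^ n) sums cnj (G z)" if "z \<in> disc" for z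
    using holomorphic_power_series[OF G(1) that] sums_cnj by (fastforce simp: b_def)
  have "harm_series h a b"
    unfolding harm_series_def hterm_def
    using sums_add[OF A B] sums_summable[OF A] sums_summable[OF B] G(2) h by (simp add: b_def)
  then show ?thesis using that by blast
qed

lemma harm_series_imp_harmonic:
  assumes "harm_series h a b"
  shows "harmonic_on disc h"
proof -
  define F where "F z = (\<Sum>n. a n * z ^ n)" for z
  define G where "G z = (\<Sum>n. cnj (b n) * z ^ n)" for z
  have A: "(\<lambda>n. a n * (z - 0) ^ n) sums F z" if "z \<in> disc" for z
    using assms that by (auto simp: harm_series_def F_def)
  have B: "(\<lambda>n. cnj (b n) * (z - 0) ^ n) sums G z" if "z \<in> disc" for z
  proof -
    have "summable (\<lambda>n. b n * cnj z ^ n)"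
      using assms that by (simp add: harm_series_def)
    then have "summable (\<lambda>n. cnj (b n * cnj z ^ n))"
      using sums_summable[OF iffD2[OF sums_cnj summable_sums]] by blast
    then show ?thesis by (simp add: G_def summable_sums)
  qed
  have "(\<lambda>n. hterm a b n z) sums (F z + cnj (G z))" if "z \<in> disc" for z
    using sums_add[OF A[OF that] iffD2[OF sums_cnj B[OF that]]] by (simp add: hterm_def)
  then have "h z = F z + cnj (G z)" if "z \<in> disc" for z
    using assms that unfolding harm_series_def using sums_unique2 by blast
  then show ?thesis
    by (intro harmonic_on_disc_holomorphic_add_cnj[of F G]) (auto intro!: power_series_holomorphic A B)
qed

lemma harmonic_on_imp_continuous_on:
  assumes "harmonic_on S h" shows "continuous_on S h"
proof (intro continuous_at_imp_continuous_on ballI)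
  fix z assume z: "z \<in> S"
  obtain hx hy where "\<forall>z\<in>S. (h has_derivative (\<lambda>v. Re v *\<^sub>R hx z + Im v *\<^sub>R hy z)) (at z)"
    using assms unfolding harmonic_on_def by (elim conjE exE) blast
  then show "isCont h z" using has_derivative_continuous z by blast
qed

lemma harm_series_summable_bound:
  assumes h: "harm_series h a b" and r: "0 \<le> r" "r < 1"
  shows "summable (\<lambda>n. (cmod (a n) + cmod (b n)) * r ^ n)"
proof -
  \<comment> \<open>a point of the disc beyond radius \<open>r\<close>; being real, it serves both halves of the series\<close>
  define x where "x = complex_of_real ((1 + r) / 2)"
  have x: "x \<in> disc" "cmod (of_real r) < cmod x" "cnj x = x"
    unfolding x_def using r by (auto simp del: of_real_add of_real_divide)
  have "summable (\<lambda>n. norm (a n * of_real r ^ n))" "summable (\<lambda>n. norm (b n * of_real r ^ n))"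
    using h x powser_insidea[of a x "of_real r"] powser_insidea[of b x "of_real r"]
    unfolding harm_series_def by metis+
  from summable_add[OF this] show ?thesis
    using r by (simp add: norm_mult norm_power algebra_simps)
qed

lemma hterm_bound: "cmod z \<le> r \<Longrightarrow> cmod (hterm a b n z) \<le> (cmod (a n) + cmod (b n)) * r ^ n"
proof -
  assume "cmod z \<le> r"
  then have "cmod z ^ n \<le> r ^ n" by (intro power_mono) auto
  then have "cmod (a n) * cmod z ^ n + cmod (b n) * cmod z ^ n \<le> cmod (a n) * r ^ n + cmod (b n) * r ^ n"
    by (intro add_mono mult_left_mono) auto
  moreover have "cmod (hterm a b n z) \<le> cmod (a n) * cmod z ^ n + cmod (b n) * cmod z ^ n"
    unfolding hterm_def by (rule order.trans[OF norm_triangle_ineq]) (simp add: norm_mult norm_power)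
  ultimately show ?thesis by (simp add: algebra_simps)
qed

lemma integrable_cball_continuous:
  fixes f :: "complex \<Rightarrow> 'a::euclidean_space"
  assumes f: "continuous_on disc f" and r: "r < 1"
  shows "integrable dA (\<lambda>z. indicat_real (cball 0 r) z *\<^sub>R f z)"
proof -
  have sub: "cball 0 r \<subseteq> disc" using r by auto
  then have S: "cball 0 r \<in> sets dA" unfolding sets_dA by (simp add: sets_restrict_space_iff)
  have "compact (f ` cball 0 r)"
    using continuous_on_subset[OF f sub] by (intro compact_continuous_image) auto
  then obtain B where B: "\<And>z. z \<in> cball 0 r \<Longrightarrow> norm (f z) \<le> B"
    using compact_imp_bounded bounded_iff by (metis imageI)
  show ?thesis
  proof (rule integrableI_bounded_set[OF S, where B = B])
    show "(\<lambda>z. indicat_real (cball 0 r) z *\<^sub>R f z) \<in> borel_measurable dA"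
      using S borel_measurable_dA_continuous[OF f] by (intro borel_measurable_scaleR borel_measurable_indicator)
  qed (use B in \<open>auto simp: less_top[symmetric]\<close>)
qed

lemma integrable_cball_norm_square:
  assumes "continuous_on disc h" "r < 1"
  shows "integrable dA (\<lambda>z. indicat_real (cball 0 r) z * (cmod (h z))\<^sup>2)"
  using integrable_cball_continuous[of "\<lambda>z. (cmod (h z))\<^sup>2" r, OF _ assms(2)] assms(1)
  by (simp add: continuous_on_power continuous_on_norm)

lemma integral_hterm_orthogonal:
  assumes b0: "b 0 = 0" and r: "0 \<le> r" "r < 1"
  shows "(LINT z|dA. indicat_real (cball 0 r) z *\<^sub>R (hterm a b n z * cnj (hterm a b m z)))
    = (if n = m then complex_of_real (weight a b n * r ^ (2 * n + 2)) else 0)"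
proof -
  define e where "e j k z = indicat_real (cball 0 r) z *\<^sub>R (z ^ j * cnj z ^ k)" for j k z
  have int: "integrable dA (e j k)" for j k
    unfolding e_def by (intro integrable_cball_continuous r continuous_intros)
  have val: "(LINT z|dA. e j k z) = (if j = k then complex_of_real (r ^ (2 * j + 2) / (real j + 1)) else 0)" for j k
    unfolding e_def by (rule integral_monomial_cball[OF r])
  have "indicat_real (cball 0 r) z *\<^sub>R (hterm a b n z * cnj (hterm a b m z)) =
      (a n * cnj (a m)) * e n m z + (a n * cnj (b m)) * e (n + m) 0 z
      + (b n * cnj (a m)) * e 0 (n + m) z + (b n * cnj (b m)) * e m n z" for z
    by (simp add: hterm_def e_def algebra_simps power_add indicator_def)
  then have "(LINT z|dA. indicat_real (cball 0 r) z *\<^sub>R (hterm a b n z * cnj (hterm a b m z))) =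
      (a n * cnj (a m)) * (LINT z|dA. e n m z) + (a n * cnj (b m)) * (LINT z|dA. e (n + m) 0 z)
      + (b n * cnj (a m)) * (LINT z|dA. e 0 (n + m) z) + (b n * cnj (b m)) * (LINT z|dA. e m n z)"
    by (simp add: int)
  also have "\<dots> = (if n = m then complex_of_real (weight a b n * r ^ (2 * n + 2)) else 0)"
  proof (cases "n = m")
    case True
    have "complex_of_real (weight a b n * r ^ (2 * n + 2))
        = (a n * cnj (a n) + b n * cnj (b n)) * complex_of_real (r ^ (2 * n + 2) / (real n + 1))"
      unfolding weight_def complex_norm_square[symmetric] of_real_add[symmetric] of_real_mult[symmetric]
      by simp
    moreover have "n + m = 0 \<Longrightarrow> b n = 0" using True b0 by simp
    ultimately show ?thesis using True b0 unfolding val by (auto simp: ring_distribs add_divide_distrib)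
  next
    case False
    then show ?thesis by (auto simp: val b0)
  qed
  finally show ?thesis .
qed

lemma integral_partial_sum_cball:
  assumes b0: "b 0 = 0" and r: "0 \<le> r" "r < 1"
  shows "(LINT z|dA. indicat_real (cball 0 r) z * (cmod (\<Sum>n<N. hterm a b n z))\<^sup>2)
    = (\<Sum>n<N. weight a b n * r ^ (2 * n + 2))"
proof -
  define I where "I = indicat_real (cball (0::complex) r)"
  have cont: "continuous_on disc (\<lambda>z. hterm a b n z * cnj (hterm a b m z))" for n m
    unfolding hterm_def by (intro continuous_intros)
  have int: "integrable dA (\<lambda>z. I z *\<^sub>R (hterm a b n z * cnj (hterm a b m z)))" for n m
    unfolding I_def by (rule integrable_cball_continuous[OF cont r(2)])
  have "complex_of_real (LINT z|dA. I z * (cmod (\<Sum>n<N. hterm a b n z))\<^sup>2)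
      = (LINT z|dA. complex_of_real (I z * (cmod (\<Sum>n<N. hterm a b n z))\<^sup>2))"
    by (rule integral_complex_of_real[symmetric])
  also have "(\<lambda>z. complex_of_real (I z * (cmod (\<Sum>n<N. hterm a b n z))\<^sup>2))
      = (\<lambda>z. \<Sum>n<N. \<Sum>m<N. I z *\<^sub>R (hterm a b n z * cnj (hterm a b m z)))"
  proof
    fix z
    have "complex_of_real (I z * (cmod (\<Sum>n<N. hterm a b n z))\<^sup>2)
        = complex_of_real (I z) * ((\<Sum>n<N. hterm a b n z) * (\<Sum>m<N. cnj (hterm a b m z)))"
      by (simp only: of_real_mult complex_norm_square cnj_sum)
    also have "\<dots> = complex_of_real (I z) * (\<Sum>n<N. \<Sum>m<N. hterm a b n z * cnj (hterm a b m z))"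
      by (simp only: sum_product)
    finally show "complex_of_real (I z * (cmod (\<Sum>n<N. hterm a b n z))\<^sup>2)
        = (\<Sum>n<N. \<Sum>m<N. I z *\<^sub>R (hterm a b n z * cnj (hterm a b m z)))"
      by (simp only: sum_distrib_left scaleR_conv_of_real)
  qed
  also have "(LINT z|dA. (\<Sum>n<N. \<Sum>m<N. I z *\<^sub>R (hterm a b n z * cnj (hterm a b m z))))
      = (\<Sum>n<N. \<Sum>m<N. (LINT z|dA. I z *\<^sub>R (hterm a b n z * cnj (hterm a b m z))))"
    by (subst Bochner_Integration.integral_sum, intro Bochner_Integration.integrable_sum int,
        intro sum.cong refl Bochner_Integration.integral_sum int)
  also have "\<dots> = (\<Sum>n<N. complex_of_real (weight a b n * r ^ (2 * n + 2)))"
    unfolding I_def by (simp add: integral_hterm_orthogonal[where b = b, OF b0 r])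
  finally show ?thesis unfolding I_def by (simp only: of_real_sum[symmetric] of_real_eq_iff)
qed

text \<open>On a smaller disc the partial sums are uniformly bounded, so their square norms, which
  orthogonality gives as finite sums, converge to that of \<open>h\<close>.\<close>

lemma parseval_cball:
  assumes h: "harm_series h a b" and r: "0 \<le> r" "r < 1"
  shows "(\<lambda>n. weight a b n * r ^ (2 * n + 2)) sums (LINT z|dA. indicat_real (cball 0 r) z * (cmod (h z))\<^sup>2)"
proof -
  define K where "K = (\<Sum>n. (cmod (a n) + cmod (b n)) * r ^ n)"
  note sm = harm_series_summable_bound[OF h r]
  have b0: "b 0 = 0" using h by (simp add: harm_series_def)
  have hc: "continuous_on disc h"
    by (rule harmonic_on_imp_continuous_on[OF harm_series_imp_harmonic[OF h]])
  have bound: "cmod (\<Sum>n<N. hterm a b n z) \<le> K" if "cmod z \<le> r" for N z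
  proof -
    have "cmod (\<Sum>n<N. hterm a b n z) \<le> (\<Sum>n<N. (cmod (a n) + cmod (b n)) * r ^ n)"
      by (intro sum_norm_le hterm_bound that)
    also have "\<dots> \<le> K" unfolding K_def using r by (intro sum_le_suminf sm) auto
    finally show ?thesis .
  qed
  have "(\<lambda>N. LINT z|dA. indicat_real (cball 0 r) z * (cmod (\<Sum>n<N. hterm a b n z))\<^sup>2)
      \<longlonglongrightarrow> (LINT z|dA. indicat_real (cball 0 r) z * (cmod (h z))\<^sup>2)"
  proof (rule integral_dominated_convergence[where w = "\<lambda>_. K\<^sup>2"])
    show "(\<lambda>z. indicat_real (cball 0 r) z * (cmod (h z))\<^sup>2) \<in> borel_measurable dA"
      using integrable_cball_norm_square[OF hc r(2)] by (rule borel_measurable_integrable)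
    show "(\<lambda>z. indicat_real (cball 0 r) z * (cmod (\<Sum>n<N. hterm a b n z))\<^sup>2) \<in> borel_measurable dA" for N
      by (intro borel_measurable_integrable[OF integrable_cball_norm_square] r(2))
         (auto simp: hterm_def intro!: continuous_intros)
    show "AE z in dA. (\<lambda>N. indicat_real (cball 0 r) z * (cmod (\<Sum>n<N. hterm a b n z))\<^sup>2)
        \<longlonglongrightarrow> indicat_real (cball 0 r) z * (cmod (h z))\<^sup>2"
    proof (rule AE_I2)
      fix z assume "z \<in> space dA"
      then have "(\<lambda>N. \<Sum>n<N. hterm a b n z) \<longlonglongrightarrow> h z"
        using h by (simp add: harm_series_def sums_def)
      then show "(\<lambda>N. indicat_real (cball 0 r) z * (cmod (\<Sum>n<N. hterm a b n z))\<^sup>2)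
        \<longlonglongrightarrow> indicat_real (cball 0 r) z * (cmod (h z))\<^sup>2"
        by (intro tendsto_intros)
    qed
    show "AE z in dA. norm (indicat_real (cball 0 r) z * (cmod (\<Sum>n<N. hterm a b n z))\<^sup>2) \<le> K\<^sup>2" for N
      using bound by (intro AE_I2) (auto simp: indicator_def intro!: power_mono)
  qed auto
  then show ?thesis
    unfolding sums_def by (simp only: integral_partial_sum_cball[where b = b, OF b0 r])
qed

text \<open>Each finite partial sum of \<open>weight a b n * r ^ (2 * n + 2)\<close> is at most the integral over the whole
  disc if \<open>r < 1\<close>. It is a polynomial in \<open>r\<close>, so the bound persists for \<open>r = 1\<close>.\<close>

lemma summable_weight_of_square_integrable:
  assumes h: "harm_series h a b" and int: "integrable dA (\<lambda>z. (cmod (h z))\<^sup>2)"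
  shows "summable (weight a b)" and "(\<Sum>n. weight a b n) \<le> (LINT z|dA. (cmod (h z))\<^sup>2)"
proof -
  define J where "J = (LINT z|dA. (cmod (h z))\<^sup>2)"
  have hc: "continuous_on disc h"
    by (rule harmonic_on_imp_continuous_on[OF harm_series_imp_harmonic[OF h]])
  have le: "(\<Sum>n\<le>N. weight a b n * r ^ (2 * n + 2)) \<le> J" if r: "0 \<le> r" "r < 1" for r N
  proof -
    have "(\<Sum>n\<le>N. weight a b n * r ^ (2 * n + 2)) \<le> (\<Sum>n. weight a b n * r ^ (2 * n + 2))"
      using parseval_cball[OF h r] r by (intro sum_le_suminf) (auto simp: sums_iff)
    also have "\<dots> = (LINT z|dA. indicat_real (cball 0 r) z * (cmod (h z))\<^sup>2)"
      using parseval_cball[OF h r] by (simp add: sums_iff)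
    also have "\<dots> \<le> J" unfolding J_def
      by (intro integral_mono integrable_cball_norm_square[OF hc r(2)] int) (simp add: indicator_def)
    finally show ?thesis .
  qed
  have bound: "(\<Sum>n\<le>N. weight a b n) \<le> J" for N
  proof -
    have "((\<lambda>r. \<Sum>n\<le>N. weight a b n * r ^ (2 * n + 2)) \<longlongrightarrow> (\<Sum>n\<le>N. weight a b n * 1 ^ (2 * n + 2)))
        (at_left (1::real))"
      by (intro tendsto_intros)
    moreover have "eventually (\<lambda>r. (\<Sum>n\<le>N. weight a b n * r ^ (2 * n + 2)) \<le> J) (at_left (1::real))"
    proof (rule eventually_mono[OF eventually_at_left_real[of 0 1]])
      show "(\<Sum>n\<le>N. weight a b n * r ^ (2 * n + 2)) \<le> J" if "r \<in> {0<..<1}" for r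
        using that by (intro le) auto
    qed simp
    ultimately have "(\<Sum>n\<le>N. weight a b n * 1 ^ (2 * n + 2)) \<le> J"
      by (intro tendsto_upperbound[of _ _ "at_left (1::real)"]) auto
    then show ?thesis by simp
  qed
  show sm: "summable (weight a b)"
    by (rule bounded_imp_summable[where B = J]) (auto simp: bound)
  have "(\<Sum>n<N. weight a b n) \<le> J" for N
  proof -
    have "(\<Sum>n<N. weight a b n) \<le> (\<Sum>n\<le>N. weight a b n)" by (intro sum_mono2) auto
    also note bound
    finally show ?thesis .
  qed
  then show "(\<Sum>n. weight a b n) \<le> (LINT z|dA. (cmod (h z))\<^sup>2)"
    unfolding J_def[symmetric] by (rule suminf_le_const[OF sm])
qed

text \<open>Monotone convergence along the exhaustion of the disc by concentric discs.\<close>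

lemma square_integrable_of_summable_weight:
  assumes h: "harm_series h a b" and w: "summable (weight a b)"
  shows "integrable dA (\<lambda>z. (cmod (h z))\<^sup>2)"
    and "(LINT z|dA. (cmod (h z))\<^sup>2) \<le> (\<Sum>n. weight a b n)"
proof -
  define W where "W = (\<Sum>n. weight a b n)"
  have W0: "W \<ge> 0" unfolding W_def by (intro suminf_nonneg w) simp
  define r where "r i = 1 - 1 / (real i + 1)" for i
  have r: "0 \<le> r i" "r i < 1" for i by (auto simp: r_def field_simps)
  have hc: "continuous_on disc h"
    by (rule harmonic_on_imp_continuous_on[OF harm_series_imp_harmonic[OF h]])
  have m: "(\<lambda>z. (cmod (h z))\<^sup>2) \<in> borel_measurable dA"
    by (rule borel_measurable_dA_continuous[OF continuous_on_power[OF continuous_on_norm[OF hc]]])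
  define f where "f i z = indicat_real (cball 0 (r i)) z * (cmod (h z))\<^sup>2" for i z
  have f_int: "integrable dA (f i)" for i
    unfolding f_def by (rule integrable_cball_norm_square[OF hc r(2)])
  have f_le: "(LINT z|dA. f i z) \<le> W" for i
  proof -
    have "(LINT z|dA. f i z) = (\<Sum>n. weight a b n * r i ^ (2 * n + 2))"
      using parseval_cball[OF h r(1)[of i] r(2)[of i]] unfolding f_def by (simp add: sums_iff)
    also have "\<dots> \<le> W"
      unfolding W_def
    proof (intro suminf_le w)
      show "summable (\<lambda>n. weight a b n * r i ^ (2 * n + 2))"
        using parseval_cball[OF h r(1)[of i] r(2)[of i]] by (simp add: sums_iff)
      show "weight a b n * r i ^ (2 * n + 2) \<le> weight a b n" for n
        using r[of i] by (intro mult_left_le power_le_one) auto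
    qed
    finally show ?thesis .
  qed
  have lim: "(\<lambda>i. \<integral>\<^sup>+z. ennreal (f i z) \<partial>dA) \<longlonglongrightarrow> (\<integral>\<^sup>+z. ennreal (indicator disc z * (cmod (h z))\<^sup>2) \<partial>dA)"
  proof (rule nn_integral_LIMSEQ)
    show "(\<lambda>z. ennreal (f i z)) \<in> borel_measurable dA" for i using f_int[of i] by simp
    have mono: "r i \<le> r j" if "i \<le> j" for i j using that by (auto simp: r_def field_simps)
    have "f i z \<le> f j z" if "i \<le> j" for i j z
      using mono[OF that] unfolding f_def by (intro mult_right_mono) (auto simp: indicator_def)
    then show "incseq (\<lambda>i z. ennreal (f i z))"
      by (simp add: incseq_def le_fun_def ennreal_leI)
    fix z :: complex
    show "(\<lambda>i. ennreal (f i z)) \<longlonglongrightarrow> ennreal (indicator disc z * (cmod (h z))\<^sup>2)"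
    proof (cases "z \<in> disc")
      case True
      have "(\<lambda>i. 1 - inverse (real (Suc i))) \<longlonglongrightarrow> 1 - 0"
        by (intro tendsto_diff tendsto_const LIMSEQ_inverse_real_of_nat)
      then have "r \<longlonglongrightarrow> 1" by (simp add: r_def[abs_def] inverse_eq_divide add.commute)
      then have "eventually (\<lambda>i. cmod z < r i) sequentially"
        using True by (intro order_tendstoD) auto
      then have "eventually (\<lambda>i. ennreal (f i z) = ennreal (indicator disc z * (cmod (h z))\<^sup>2)) sequentially"
        by eventually_elim (use True in \<open>simp add: f_def\<close>)
      then show ?thesis by (rule tendsto_eventually)
    next
      case False
      then have "cmod z > r i" for i using r(2)[of i] by simp
      then have "f i z = 0" for i by (simp add: f_def not_le)
      then show ?thesis using False by simp
    qed
  qed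
  have "f i z \<ge> 0" for i z by (simp add: f_def)
  then have "(\<integral>\<^sup>+z. ennreal (f i z) \<partial>dA) \<le> ennreal W" for i
    using f_int f_le by (simp add: nn_integral_eq_integral ennreal_leI)
  then have "(\<integral>\<^sup>+z. ennreal (indicator disc z * (cmod (h z))\<^sup>2) \<partial>dA) \<le> ennreal W"
    by (intro LIMSEQ_le_const2[OF lim]) simp
  also have "(\<integral>\<^sup>+z. ennreal (indicator disc z * (cmod (h z))\<^sup>2) \<partial>dA) = (\<integral>\<^sup>+z. ennreal ((cmod (h z))\<^sup>2) \<partial>dA)"
    by (intro nn_integral_cong) auto
  finally have le: "(\<integral>\<^sup>+z. ennreal ((cmod (h z))\<^sup>2) \<partial>dA) \<le> ennreal W" .
  show int: "integrable dA (\<lambda>z. (cmod (h z))\<^sup>2)"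
    using le_less_trans[OF le ennreal_less_top] by (intro integrableI_bounded m) simp
  have "ennreal (LINT z|dA. (cmod (h z))\<^sup>2) \<le> ennreal W"
    using le nn_integral_eq_integral[OF int] by simp
  then show "(LINT z|dA. (cmod (h z))\<^sup>2) \<le> (\<Sum>n. weight a b n)"
    using W0 unfolding W_def by simp
qed


section \<open>The Hilbert space structure of the harmonic Bergman space\<close>

lemma Lh2I:
  assumes "harmonic_on disc h" "integrable dA (\<lambda>z. (cmod (h z))\<^sup>2)" "\<And>z. z \<notin> disc \<Longrightarrow> h z = 0"
  shows "h \<in> Lh2"
  using assms by (simp add: Lh2_def)

lemma Lh2_D:
  assumes "h \<in> Lh2"
  shows "harmonic_on disc h" "integrable dA (\<lambda>z. (cmod (h z))\<^sup>2)" "z \<notin> disc \<Longrightarrow> h z = 0"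
  using assms by (auto simp: Lh2_def)

lemma Lh2_measurable: "h \<in> Lh2 \<Longrightarrow> h \<in> borel_measurable dA"
  by (rule borel_measurable_dA_continuous[OF harmonic_on_imp_continuous_on[OF Lh2_D(1)]])

lemma Lh2_series:
  assumes "h \<in> Lh2"
  obtains a b where "harm_series h a b"
  using harmonic_on_disc_imp_series[OF Lh2_D(1)[OF assms]] by blast

lemma integrable_mult_Lh2:
  assumes g: "g \<in> Lh2" and h: "h \<in> Lh2"
  shows "integrable dA (\<lambda>z. g z * h z)"
proof (rule Bochner_Integration.integrable_bound)
  show "integrable dA (\<lambda>z. (cmod (g z))\<^sup>2 + (cmod (h z))\<^sup>2)"
    using Lh2_D(2) g h by (intro Bochner_Integration.integrable_add)
  show "(\<lambda>z. g z * h z) \<in> borel_measurable dA"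
    using Lh2_measurable g h by (intro borel_measurable_times)
  have "cmod (g z) * cmod (h z) \<le> (cmod (g z))\<^sup>2 + (cmod (h z))\<^sup>2" for z
    using sum_squares_bound[of "cmod (g z)" "cmod (h z)"]
      mult_nonneg_nonneg[OF norm_ge_zero[of "g z"] norm_ge_zero[of "h z"]]
    by linarith
  then show "AE z in dA. norm (g z * h z) \<le> norm ((cmod (g z))\<^sup>2 + (cmod (h z))\<^sup>2)"
    by (intro AE_I2) (simp add: norm_mult)
qed

lemma harmonic_on_disc_lincomb:
  assumes "harmonic_on disc g" "harmonic_on disc h"
  shows "harmonic_on disc (\<lambda>z. g z + c * h z)"
proof -
  obtain F G where 1: "F holomorphic_on disc" "G holomorphic_on disc" "\<And>z. z \<in> disc \<Longrightarrow> g z = F z + cnj (G z)"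
    using harmonic_on_disc_decompose[OF assms(1)] by metis
  obtain F' G' where 2: "F' holomorphic_on disc" "G' holomorphic_on disc" "\<And>z. z \<in> disc \<Longrightarrow> h z = F' z + cnj (G' z)"
    using harmonic_on_disc_decompose[OF assms(2)] by metis
  show ?thesis
    by (rule harmonic_on_disc_holomorphic_add_cnj[of "\<lambda>z. F z + c * F' z" "\<lambda>z. G z + cnj c * G' z"])
       (auto intro!: holomorphic_intros 1 2 simp: 1(3) 2(3) algebra_simps)
qed

lemma harmonic_on_disc_cnj:
  assumes "harmonic_on disc h"
  shows "harmonic_on disc (\<lambda>z. cnj (h z))"
proof -
  obtain F G where 1: "F holomorphic_on disc" "G holomorphic_on disc" "\<And>z. z \<in> disc \<Longrightarrow> h z = F z + cnj (G z)"
    using harmonic_on_disc_decompose[OF assms(1)] by metis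
  show ?thesis
    by (rule harmonic_on_disc_holomorphic_add_cnj[of G F]) (auto simp: 1)
qed

lemma Lh2_lincomb:
  assumes g: "g \<in> Lh2" and h: "h \<in> Lh2"
  shows "(\<lambda>z. g z + c * h z) \<in> Lh2"
proof (rule Lh2I)
  show "harmonic_on disc (\<lambda>z. g z + c * h z)"
    by (rule harmonic_on_disc_lincomb[OF Lh2_D(1)[OF g] Lh2_D(1)[OF h]])
  show "g z + c * h z = 0" if "z \<notin> disc" for z
    using Lh2_D(3)[OF g that] Lh2_D(3)[OF h that] by simp
  show "integrable dA (\<lambda>z. (cmod (g z + c * h z))\<^sup>2)"
  proof (rule Bochner_Integration.integrable_bound)
    show "integrable dA (\<lambda>z. 2 * (cmod (g z))\<^sup>2 + 2 * (cmod c)\<^sup>2 * (cmod (h z))\<^sup>2)"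
      using Lh2_D(2) g h by (intro Bochner_Integration.integrable_add integrable_mult_right) auto
    show "(\<lambda>z. (cmod (g z + c * h z))\<^sup>2) \<in> borel_measurable dA"
      using Lh2_measurable[OF g] Lh2_measurable[OF h] by measurable
    have "(cmod (g z + c * h z))\<^sup>2 \<le> 2 * (cmod (g z))\<^sup>2 + 2 * (cmod c)\<^sup>2 * (cmod (h z))\<^sup>2" for z
    proof -
      have "(cmod (g z + c * h z))\<^sup>2 \<le> (cmod (g z) + cmod c * cmod (h z))\<^sup>2"
        by (intro power_mono order.trans[OF norm_triangle_ineq]) (auto simp: norm_mult)
      also have "\<dots> \<le> 2 * (cmod (g z))\<^sup>2 + 2 * (cmod c)\<^sup>2 * (cmod (h z))\<^sup>2"
        using sum_squares_bound[of "cmod (g z)" "cmod c * cmod (h z)"]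
        by (simp add: power2_sum power_mult_distrib)
      finally show ?thesis .
    qed
    then show "AE z in dA. norm ((cmod (g z + c * h z))\<^sup>2) \<le> norm (2 * (cmod (g z))\<^sup>2 + 2 * (cmod c)\<^sup>2 * (cmod (h z))\<^sup>2)"
      by (intro AE_I2) simp
  qed
qed

lemma zero_Lh2: "(\<lambda>z. 0) \<in> Lh2"
  by (rule Lh2I, rule harmonic_on_disc_holomorphic_add_cnj[of "\<lambda>_. 0" "\<lambda>_. 0"]) auto

lemma scale_Lh2: "h \<in> Lh2 \<Longrightarrow> (\<lambda>z. c * h z) \<in> Lh2"
  using Lh2_lincomb[OF zero_Lh2, of h c] by simp

lemma add_Lh2: "g \<in> Lh2 \<Longrightarrow> h \<in> Lh2 \<Longrightarrow> g + h \<in> Lh2"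
  using Lh2_lincomb[of g h 1] by (simp add: plus_fun_def)

lemma diff_Lh2: "g \<in> Lh2 \<Longrightarrow> h \<in> Lh2 \<Longrightarrow> g - h \<in> Lh2"
  using Lh2_lincomb[of g h "-1"] by (simp add: fun_diff_def)

lemma cnj_Lh2: "h \<in> Lh2 \<Longrightarrow> (\<lambda>z. cnj (h z)) \<in> Lh2"
  by (auto intro!: Lh2I harmonic_on_disc_cnj dest: Lh2_D)

definition ip :: "(complex \<Rightarrow> complex) \<Rightarrow> (complex \<Rightarrow> complex) \<Rightarrow> complex" where
  "ip g h = (LINT z|dA. g z * cnj (h z))"

definition bilin :: "(complex \<Rightarrow> complex) \<Rightarrow> (complex \<Rightarrow> complex) \<Rightarrow> complex" where
  "bilin g h = (LINT z|dA. g z * h z)"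

lemma bilin_commute: "bilin g h = bilin h g"
  by (simp add: bilin_def mult.commute)

lemma ip_eq_bilin: "ip g h = bilin g (\<lambda>z. cnj (h z))"
  by (simp add: bilin_def ip_def)

lemma bilin_lincomb_left:
  assumes "g \<in> Lh2" "h \<in> Lh2" "k \<in> Lh2"
  shows "bilin (\<lambda>z. g z + c * h z) k = bilin g k + c * bilin h k"
  using assms by (simp add: bilin_def distrib_right mult.assoc integrable_mult_Lh2)

lemma bilin_diff_left:
  assumes "g \<in> Lh2" "h \<in> Lh2" "k \<in> Lh2"
  shows "bilin (g - h) k = bilin g k - bilin h k"
  using bilin_lincomb_left[OF assms, of "-1"] by (simp add: fun_diff_def)

lemma bilin_diff_right:
  assumes "g \<in> Lh2" "h \<in> Lh2" "k \<in> Lh2"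
  shows "bilin k (g - h) = bilin k g - bilin k h"
  using bilin_diff_left[OF assms] by (simp add: bilin_commute[of k])

lemma norm2_nonneg [simp]: "norm2 h \<ge> 0"
  by (simp add: norm2_def)

lemma norm2_square: "(norm2 h)\<^sup>2 = (LINT z|dA. (cmod (h z))\<^sup>2)"
  by (simp add: norm2_def integral_nonneg_AE)

lemma ip_self: "ip h h = complex_of_real ((norm2 h)\<^sup>2)"
  unfolding norm2_square integral_complex_of_real[symmetric] by (simp only: ip_def complex_norm_square)

lemma norm2_square_add:
  assumes "g \<in> Lh2" "h \<in> Lh2"
  shows "(norm2 (g + h))\<^sup>2 = (norm2 g)\<^sup>2 + (norm2 h)\<^sup>2 + 2 * Re (ip g h)"
proof -
  have pt: "(cmod ((g + h) z))\<^sup>2 = (cmod (g z))\<^sup>2 + (cmod (h z))\<^sup>2 + 2 * Re (g z * cnj (h z))" for z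
    unfolding plus_fun_def cmod_power2 by (simp add: power2_eq_square algebra_simps)
  have int: "integrable dA (\<lambda>z. g z * cnj (h z))"
    using integrable_mult_Lh2[OF assms(1) cnj_Lh2[OF assms(2)]] .
  then have "integrable dA (\<lambda>z. Re (g z * cnj (h z)))" by (rule integrable_Re)
  moreover have "(LINT z|dA. Re (g z * cnj (h z))) = Re (ip g h)"
    unfolding ip_def by (rule integral_Re[OF int])
  ultimately show ?thesis unfolding norm2_square pt
    using Lh2_D(2) assms by (simp del: times_complex.sel)
qed

lemma norm2_cnj: "norm2 (\<lambda>z. cnj (h z)) = norm2 h"
  by (simp add: norm2_def)

lemma norm2_minus_commute: "norm2 (g - h) = norm2 (h - g)"
  by (simp add: norm2_def norm_minus_commute)

text \<open>Letting \<open>r\<close> tend to \<open>1\<close> in the identity on smaller discs has given both inequalities.\<close>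

lemma parseval:
  assumes h: "h \<in> Lh2" and s: "harm_series h a b"
  shows "weight a b sums (norm2 h)\<^sup>2"
proof -
  note int = Lh2_D(2)[OF h]
  note sm = summable_weight_of_square_integrable[OF s int]
  have "(\<Sum>n. weight a b n) = (norm2 h)\<^sup>2"
    unfolding norm2_square using sm(2) square_integrable_of_summable_weight(2)[OF s sm(1)] by simp
  then show ?thesis using sm(1) by (simp add: sums_iff)
qed

text \<open>By Parseval, all coefficients of a function of norm \<open>0\<close> vanish.\<close>

lemma norm2_eq_0_iff:
  assumes h: "h \<in> Lh2"
  shows "norm2 h = 0 \<longleftrightarrow> h = 0"
proof
  assume 0: "norm2 h = 0"
  obtain a b where s: "harm_series h a b" using Lh2_series[OF h] .
  have w: "weight a b sums 0" using parseval[OF h s] 0 by simp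
  have "weight a b n = 0" for n
    using w suminf_eq_zero_iff[of "weight a b"] by (auto simp: sums_iff)
  then have "a n = 0 \<and> b n = 0" for n
    by (auto simp: weight_def add_nonneg_eq_0_iff)
  then have t0: "hterm a b n z = 0" for n z by (simp add: hterm_def)
  show "h = 0"
  proof
    fix z
    show "h z = 0 z"
    proof (cases "z \<in> disc")
      case True
      then have "(\<lambda>n. hterm a b n z) sums h z" using s by (simp add: harm_series_def)
      then show ?thesis by (simp add: t0 sums_iff)
    qed (simp add: Lh2_D(3)[OF h])
  qed
qed (simp add: norm2_def)

text \<open>The pointwise inequality \<open>x y \<le> (s x\<^sup>2 + y\<^sup>2 / s) / 2\<close> is integrated with \<open>s = H / G\<close>, the choice for which
  the right-hand side becomes \<open>G H\<close>.\<close>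

lemma bilin_Cauchy_Schwarz:
  assumes g: "g \<in> Lh2" and h: "h \<in> Lh2"
  shows "cmod (bilin g h) \<le> norm2 g * norm2 h"
proof (cases "g = 0 \<or> h = 0")
  case True
  then show ?thesis by (auto simp: bilin_def norm2_def)
next
  case False
  define G H where "G = norm2 g" and "H = norm2 h"
  have pos: "G > 0" "H > 0"
    using False norm2_eq_0_iff[OF g] norm2_eq_0_iff[OF h] norm2_nonneg[of g] norm2_nonneg[of h]
    unfolding G_def H_def by linarith+
  have "cmod (bilin g h) \<le> (LINT z|dA. cmod (g z * h z))"
    unfolding bilin_def by (rule integral_norm_bound)
  also have "\<dots> \<le> (LINT z|dA. (H / (2 * G)) * (cmod (g z))\<^sup>2 + (G / (2 * H)) * (cmod (h z))\<^sup>2)"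
  proof (rule integral_mono)
    show "integrable dA (\<lambda>z. cmod (g z * h z))"
      using integrable_mult_Lh2[OF g h] by (rule integrable_norm)
    show "integrable dA (\<lambda>z. (H / (2 * G)) * (cmod (g z))\<^sup>2 + (G / (2 * H)) * (cmod (h z))\<^sup>2)"
      using Lh2_D(2) g h by (intro Bochner_Integration.integrable_add integrable_mult_right) auto
    fix z
    define x y where "x = cmod (g z)" and "y = cmod (h z)"
    have "0 \<le> (H * x - G * y)\<^sup>2 / (2 * G * H)" using pos by simp
    also have "\<dots> = (H / (2 * G)) * x\<^sup>2 + (G / (2 * H)) * y\<^sup>2 - x * y"
      using pos by (simp add: field_simps power2_eq_square)
    finally show "cmod (g z * h z) \<le> (H / (2 * G)) * (cmod (g z))\<^sup>2 + (G / (2 * H)) * (cmod (h z))\<^sup>2"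
      by (simp add: norm_mult x_def y_def)
  qed
  also have "\<dots> = (H / (2 * G)) * G\<^sup>2 + (G / (2 * H)) * H\<^sup>2"
    unfolding G_def H_def norm2_square using Lh2_D(2) g h by simp
  also have "\<dots> = G * H" using pos by (simp add: field_simps power2_eq_square)
  finally show ?thesis by (simp add: G_def H_def)
qed

lemma norm2_triangle:
  assumes g: "g \<in> Lh2" and h: "h \<in> Lh2"
  shows "norm2 (g + h) \<le> norm2 g + norm2 h"
proof (rule power2_le_imp_le)
  have "Re (ip g h) \<le> cmod (ip g h)" by (rule complex_Re_le_cmod)
  also have "\<dots> \<le> norm2 g * norm2 h"
    unfolding ip_eq_bilin using bilin_Cauchy_Schwarz[OF g cnj_Lh2[OF h]] by (simp add: norm2_cnj)
  finally show "(norm2 (g + h))\<^sup>2 \<le> (norm2 g + norm2 h)\<^sup>2"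
    unfolding norm2_square_add[OF g h] by (simp add: power2_sum)
qed simp

lemma norm2_triangle_diff:
  assumes "f \<in> Lh2" "g \<in> Lh2" "h \<in> Lh2"
  shows "norm2 (f - h) \<le> norm2 (f - g) + norm2 (g - h)"
  using norm2_triangle[of "f - g" "g - h"] diff_Lh2 assms by (simp add: algebra_simps)

lemma harm_series_lincomb:
  assumes "harm_series g a b" "harm_series h a' b'"
  shows "harm_series (\<lambda>z. g z + c * h z) (\<lambda>n. a n + c * a' n) (\<lambda>n. b n + c * b' n)"
  unfolding harm_series_def
proof (intro conjI ballI)
  show "b 0 + c * b' 0 = 0" using assms by (simp add: harm_series_def)
  fix z assume z: "z \<in> disc"
  have s: "summable (\<lambda>n. a n * z ^ n)" "summable (\<lambda>n. c * (a' n * z ^ n))"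
    "summable (\<lambda>n. b n * cnj z ^ n)" "summable (\<lambda>n. c * (b' n * cnj z ^ n))"
    using assms z by (auto simp: harm_series_def intro!: summable_mult)
  show "summable (\<lambda>n. (a n + c * a' n) * z ^ n)"
    using summable_add[OF s(1,2)] by (simp add: algebra_simps)
  show "summable (\<lambda>n. (b n + c * b' n) * cnj z ^ n)"
    using summable_add[OF s(3,4)] by (simp add: algebra_simps)
  have "(\<lambda>n. hterm a b n z) sums g z" "(\<lambda>n. hterm a' b' n z) sums h z"
    using assms z by (auto simp: harm_series_def)
  from sums_add[OF this(1) sums_mult[OF this(2), of c]]
  show "(\<lambda>n. hterm (\<lambda>n. a n + c * a' n) (\<lambda>n. b n + c * b' n) n z) sums (g z + c * h z)"
    by (simp add: hterm_def algebra_simps)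
qed

lemma harm_series_diff:
  assumes "harm_series g a b" "harm_series h a' b'"
  shows "harm_series (g - h) (\<lambda>n. a n - a' n) (\<lambda>n. b n - b' n)"
  using harm_series_lincomb[OF assms, of "-1"] by (simp add: fun_diff_def)

text \<open>The Parseval identity polarized.\<close>

lemma Re_ip_sums:
  assumes g: "g \<in> Lh2" "harm_series g a b" and h: "h \<in> Lh2" "harm_series h a' b'"
  shows "(\<lambda>n. Re (a n * cnj (a' n) + b n * cnj (b' n)) / (real n + 1)) sums Re (ip g h)"
proof -
  have gh: "(\<lambda>z. g z + 1 * h z) = g + h" by (simp add: plus_fun_def)
  have "(\<lambda>n. (weight (\<lambda>n. a n + 1 * a' n) (\<lambda>n. b n + 1 * b' n) n - weight a b n - weight a' b' n) / 2)
      sums (((norm2 (g + h))\<^sup>2 - (norm2 g)\<^sup>2 - (norm2 h)\<^sup>2) / 2)"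
    using parseval[OF _ harm_series_lincomb[OF g(2) h(2), of 1]] parseval[OF g] parseval[OF h] add_Lh2[OF g(1) h(1)]
    unfolding gh by (intro sums_divide sums_diff) auto
  moreover have "(weight (\<lambda>n. a n + 1 * a' n) (\<lambda>n. b n + 1 * b' n) n - weight a b n - weight a' b' n) / 2
      = Re (a n * cnj (a' n) + b n * cnj (b' n)) / (real n + 1)" for n
    unfolding weight_def diff_divide_distrib[symmetric] divide_divide_eq_left
    by (simp add: cmod_power2 field_simps) (simp add: power2_eq_square algebra_simps)
  moreover have "((norm2 (g + h))\<^sup>2 - (norm2 g)\<^sup>2 - (norm2 h)\<^sup>2) / 2 = Re (ip g h)"
    using norm2_square_add[OF g(1) h(1)] by simp
  ultimately show ?thesis by (simp only:)
qed

text \<open>Polarization yields real parts only; the imaginary part is the real part for \<open>- \<i> g\<close>.\<close>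

lemma ip_single_term:
  assumes g: "g \<in> Lh2" "harm_series g a b" and h: "h \<in> Lh2" "harm_series h a' b'"
    and single: "\<And>n. n \<noteq> m \<Longrightarrow> a' n = 0 \<and> b' n = 0"
  shows "ip g h = (a m * cnj (a' m) + b m * cnj (b' m)) / complex_of_real (real m + 1)"
proof -
  have val: "Re (ip k h) = Re (c m * cnj (a' m) + d m * cnj (b' m)) / (real m + 1)"
    if k: "k \<in> Lh2" "harm_series k c d" for k c d
  proof -
    define f where "f n = Re (c n * cnj (a' n) + d n * cnj (b' n)) / (real n + 1)" for n
    have "(\<lambda>n. if n = m then f n else 0) = f"
      using single by (auto simp: fun_eq_iff f_def)
    then have "f sums f m" using sums_single[of m f] by simp
    moreover have "f sums Re (ip k h)" unfolding f_def by (rule Re_ip_sums[OF k h])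
    ultimately show ?thesis unfolding f_def[symmetric] by (rule sums_unique2[symmetric])
  qed
  have z: "harm_series (\<lambda>z. 0) (\<lambda>n. 0) (\<lambda>n. 0)" by (simp add: harm_series_def hterm_def)
  have s: "harm_series (\<lambda>z. 0 + (- \<i>) * g z) (\<lambda>n. 0 + (- \<i>) * a n) (\<lambda>n. 0 + (- \<i>) * b n)"
    by (rule harm_series_lincomb[OF z g(2)])
  have m: "(\<lambda>z. 0 + (- \<i>) * g z) \<in> Lh2" by (rule Lh2_lincomb[OF zero_Lh2 g(1)])
  have "ip (\<lambda>z. 0 + (- \<i>) * g z) h = - \<i> * ip g h"
    unfolding ip_eq_bilin bilin_lincomb_left[OF zero_Lh2 g(1) cnj_Lh2[OF h(1)]] by (simp add: bilin_def)
  then have "Im (ip g h) = Re (ip (\<lambda>z. 0 + (- \<i>) * g z) h)" by simp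
  also have "\<dots> = Im (a m * cnj (a' m) + b m * cnj (b' m)) / (real m + 1)"
    unfolding val[OF m s] by (simp add: algebra_simps)
  finally show ?thesis
    using val[OF g] by (simp only: complex_eq_iff Re_divide_of_real Im_divide_of_real)
qed


section \<open>Harmonic functions with prescribed coefficients\<close>

definition harm_fun :: "(nat \<Rightarrow> complex) \<Rightarrow> (nat \<Rightarrow> complex) \<Rightarrow> complex \<Rightarrow> complex" where
  "harm_fun a b z = (if z \<in> disc then (\<Sum>n. hterm a b n z) else 0)"

lemma summable_Suc_power:
  assumes "0 \<le> r" "r < (1::real)"
  shows "summable (\<lambda>n. K * (real (Suc n) * r ^ n))"
  using geometric_deriv_sums[of r] assms by (intro summable_mult) (auto simp: sums_iff)

lemma summable_power_of_linear_bound: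
  assumes c: "\<And>n. cmod (c n) \<le> K * real (Suc n)" and z: "z \<in> disc"
  shows "summable (\<lambda>n. c n * z ^ n)"
proof (rule summable_comparison_test)
  show "summable (\<lambda>n. K * (real (Suc n) * cmod z ^ n))"
    using z by (intro summable_Suc_power) auto
  show "\<exists>N. \<forall>n\<ge>N. norm (c n * z ^ n) \<le> K * (real (Suc n) * cmod z ^ n)"
    using mult_right_mono[OF c, of "cmod z ^ n" for n]
    by (auto simp: norm_mult norm_power mult.assoc simp del: of_nat_Suc)
qed

text \<open>A summable weight is bounded, so the squares of the coefficients grow at most linearly; a linear
  bound on the coefficients themselves is enough for convergence in the disc.\<close>

lemma coefficients_linear_bound:
  assumes "summable (weight a b)"
  obtains K where "\<And>n. cmod (a n) \<le> K * real (Suc n)" "\<And>n. cmod (b n) \<le> K * real (Suc n)"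
proof
  define K where "K = (\<Sum>n. weight a b n)"
  have K: "weight a b n \<le> K" for n
    unfolding K_def using sum_le_suminf[OF assms, of "{n}"] by simp
  have sq: "(cmod (a n))\<^sup>2 + (cmod (b n))\<^sup>2 \<le> K * real (Suc n)" for n
    using K[of n] by (simp add: weight_def divide_le_eq add.commute)
  have le: "x \<le> 1 + x\<^sup>2" for x :: real
    using sum_squares_bound[of x 1] zero_le_power2[of x] unfolding power_one by linarith
  show "cmod (a n) \<le> (1 + K) * real (Suc n)" for n
  proof -
    have "cmod (a n) \<le> 1 + K * real (Suc n)"
      using le[of "cmod (a n)"] sq[of n] zero_le_power2[of "cmod (b n)"] by linarith
    then show ?thesis by (simp add: algebra_simps)
  qed
  show "cmod (b n) \<le> (1 + K) * real (Suc n)" for n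
  proof -
    have "cmod (b n) \<le> 1 + K * real (Suc n)"
      using le[of "cmod (b n)"] sq[of n] zero_le_power2[of "cmod (a n)"] by linarith
    then show ?thesis by (simp add: algebra_simps)
  qed
qed

lemma harm_fun_series_of_linear_bound:
  assumes b0: "b 0 = 0" and a: "\<And>n. cmod (a n) \<le> K * real (Suc n)" and b: "\<And>n. cmod (b n) \<le> K * real (Suc n)"
  shows "harm_series (harm_fun a b) a b"
  unfolding harm_series_def
proof (intro conjI ballI b0)
  fix z assume z: "z \<in> disc"
  then have cz: "cnj z \<in> disc" by simp
  note sm = summable_power_of_linear_bound[OF a z] summable_power_of_linear_bound[OF b cz]
  show "summable (\<lambda>n. a n * z ^ n)" "summable (\<lambda>n. b n * cnj z ^ n)" by (fact sm)+
  show "(\<lambda>n. hterm a b n z) sums harm_fun a b z"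
    unfolding harm_fun_def hterm_def using summable_add[OF sm] z by (simp add: summable_sums)
qed

lemma harm_fun_Lh2:
  assumes b0: "b 0 = 0" and w: "summable (weight a b)"
  shows "harm_series (harm_fun a b) a b" and "harm_fun a b \<in> Lh2"
proof -
  obtain K where "\<And>n. cmod (a n) \<le> K * real (Suc n)" "\<And>n. cmod (b n) \<le> K * real (Suc n)"
    using coefficients_linear_bound[OF w] by blast
  then show s: "harm_series (harm_fun a b) a b"
    by (rule harm_fun_series_of_linear_bound[of b, OF b0])
  show "harm_fun a b \<in> Lh2"
    by (rule Lh2I[OF harm_series_imp_harmonic[OF s] square_integrable_of_summable_weight(1)[OF s w]])
       (simp add: harm_fun_def)
qed

section \<open>Density of harmonic polynomials\<close>

definition disc_poly :: "(nat \<Rightarrow> complex) \<Rightarrow> (nat \<Rightarrow> complex) \<Rightarrow> nat \<Rightarrow> complex \<Rightarrow> complex" where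
  "disc_poly a b N z = (if z \<in> disc then (\<Sum>n<N. hterm a b n z) else 0)"

definition truncate :: "nat \<Rightarrow> (nat \<Rightarrow> complex) \<Rightarrow> nat \<Rightarrow> complex" where
  "truncate N a n = (if n < N then a n else 0)"

lemma weight_truncate: "weight (truncate N a) (truncate N b) = (\<lambda>n. if n < N then weight a b n else 0)"
  by (auto simp: fun_eq_iff weight_def truncate_def)

lemma sums_truncate: "(\<lambda>n. if n < N then f n else 0) sums (\<Sum>n<N. f n)"
  for f :: "nat \<Rightarrow> 'a::real_normed_vector"
  using sums_If_finite[of "\<lambda>n. n < N" f] by (simp add: lessThan_def)

lemma disc_poly_eq_harm_fun: "disc_poly a b N = harm_fun (truncate N a) (truncate N b)"
proof
  fix z
  have "(\<lambda>n. hterm (truncate N a) (truncate N b) n z) = (\<lambda>n. if n < N then hterm a b n z else 0)"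
    by (auto simp: hterm_def truncate_def)
  then show "disc_poly a b N z = harm_fun (truncate N a) (truncate N b) z"
    using sums_truncate[of N "\<lambda>n. hterm a b n z"] by (simp add: disc_poly_def harm_fun_def sums_iff)
qed

lemma disc_poly_Lh2:
  assumes "b 0 = 0"
  shows "harm_series (disc_poly a b N) (truncate N a) (truncate N b)" and "disc_poly a b N \<in> Lh2"
proof -
  have "summable (weight (truncate N a) (truncate N b))"
    unfolding weight_truncate using sums_truncate sums_summable by blast
  moreover have "truncate N b 0 = 0" using assms by (simp add: truncate_def)
  ultimately show "harm_series (disc_poly a b N) (truncate N a) (truncate N b)" "disc_poly a b N \<in> Lh2"
    unfolding disc_poly_eq_harm_fun by (auto intro: harm_fun_Lh2)
qed

text \<open>The square of the distance from \<open>h\<close> to the truncated series is the tail of the Parseval sum.\<close>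

lemma disc_poly_tendsto:
  assumes h: "h \<in> Lh2" "harm_series h a b"
  shows "(\<lambda>N. norm2 (disc_poly a b N - h)) \<longlonglongrightarrow> 0"
proof -
  have b0: "b 0 = 0" using h by (simp add: harm_series_def)
  define S where "S = (norm2 h)\<^sup>2"
  have S: "weight a b sums S" unfolding S_def by (rule parseval[OF h])
  have sq: "(norm2 (h - disc_poly a b N))\<^sup>2 = S - (\<Sum>n<N. weight a b n)" for N
  proof -
    have "weight (\<lambda>n. a n - truncate N a n) (\<lambda>n. b n - truncate N b n) sums (norm2 (h - disc_poly a b N))\<^sup>2"
      by (rule parseval[OF diff_Lh2[OF h(1) disc_poly_Lh2(2)[of b, OF b0]] harm_series_diff[OF h(2) disc_poly_Lh2(1)[of b, OF b0]]])
    moreover have "weight (\<lambda>n. a n - truncate N a n) (\<lambda>n. b n - truncate N b n) = (\<lambda>n. weight a b n - (if n < N then weight a b n else 0))"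
      by (auto simp: fun_eq_iff weight_def truncate_def)
    ultimately show ?thesis
      using sums_diff[OF S sums_truncate[of N "weight a b"]] sums_unique2 by metis
  qed
  have "(\<lambda>N. S - (\<Sum>n<N. weight a b n)) \<longlonglongrightarrow> S - S"
    using S unfolding sums_def by (intro tendsto_diff tendsto_const)
  then have "(\<lambda>N. sqrt ((norm2 (h - disc_poly a b N))\<^sup>2)) \<longlonglongrightarrow> sqrt 0"
    unfolding sq by (intro tendsto_real_sqrt) simp
  then show ?thesis by (simp add: norm2_minus_commute[of _ h])
qed

text \<open>The binomial theorem expands \<open>(x + \<i> y)\<^sup>n\<close> and \<open>(x - \<i> y)\<^sup>n\<close> into monomials in \<open>x\<close> and \<open>y\<close>; sorting them by
  both exponents turns the triangular sum into the square one of \<open>harmonic_polys\<close>.\<close>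

lemma disc_poly_harmonic_polys:
  assumes "b 0 = 0"
  shows "disc_poly a b N \<in> harmonic_polys"
  unfolding harmonic_polys_def
proof (intro CollectI conjI disc_poly_Lh2(2)[of b, OF assms] exI ballI)
  fix z assume z: "z \<in> disc"
  define c where "c j k = (if j + k < N then of_nat ((j + k) choose j) * (a (j + k) * \<i> ^ k + b (j + k) * (- \<i>) ^ k) else 0)" for j k
  define x y where "x = complex_of_real (Re z)" and "y = complex_of_real (Im z)"
  have zx: "z = x + \<i> * y" "cnj z = x + (- \<i>) * y" by (simp_all add: x_def y_def complex_eq_iff)
  have expand: "hterm a b n z = (\<Sum>i\<le>n. of_nat (n choose i) * (a n * \<i> ^ (n - i) + b n * (- \<i>) ^ (n - i)) * x ^ i * y ^ (n - i))" for n
  proof -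
    have "hterm a b n z = a n * (\<Sum>i\<le>n. of_nat (n choose i) * x ^ i * (\<i> * y) ^ (n - i))
        + b n * (\<Sum>i\<le>n. of_nat (n choose i) * x ^ i * ((- \<i>) * y) ^ (n - i))"
    proof -
      have "z ^ n = (\<Sum>i\<le>n. of_nat (n choose i) * x ^ i * (\<i> * y) ^ (n - i))"
        unfolding zx(1) by (rule binomial_ring)
      moreover have "cnj z ^ n = (\<Sum>i\<le>n. of_nat (n choose i) * x ^ i * ((- \<i>) * y) ^ (n - i))"
        unfolding zx(2) by (rule binomial_ring)
      ultimately show ?thesis by (simp only: hterm_def)
    qed
    also have "\<dots> = (\<Sum>i\<le>n. of_nat (n choose i) * (a n * \<i> ^ (n - i) + b n * (- \<i>) ^ (n - i)) * x ^ i * y ^ (n - i))"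
      unfolding sum_distrib_left sum.distrib[symmetric] power_mult_distrib
      by (intro sum.cong refl) (simp add: algebra_simps)
    finally show ?thesis .
  qed
  have "disc_poly a b N z = (\<Sum>n<N. \<Sum>i\<le>n. c i (n - i) * x ^ i * y ^ (n - i))"
    unfolding disc_poly_def expand using z by (auto intro!: sum.cong simp: c_def)
  also have "\<dots> = (\<Sum>(i, j) | i + j < N. c i j * x ^ i * y ^ j)"
    by (rule sum.triangle_reindex[symmetric])
  also have "\<dots> = (\<Sum>(i, j)\<in>{..N} \<times> {..N}. c i j * x ^ i * y ^ j)"
    by (rule sum.mono_neutral_left) (auto simp: c_def split: if_splits)
  also have "\<dots> = (\<Sum>j\<le>N. \<Sum>k\<le>N. c j k * x ^ j * y ^ k)"
    by (rule sum.cartesian_product[symmetric])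
  finally show "disc_poly a b N z = (\<Sum>j\<le>N. \<Sum>k\<le>N.
      (if j + k < N then of_nat ((j + k) choose j) * (a (j + k) * \<i> ^ k + b (j + k) * (- \<i>) ^ k) else 0)
      * complex_of_real (Re z) ^ j * complex_of_real (Im z) ^ k)"
    unfolding c_def x_def y_def .
qed

lemma harmonic_polys_diff:
  assumes "p \<in> harmonic_polys" "q \<in> harmonic_polys"
  shows "p - q \<in> harmonic_polys"
proof -
  obtain n c where p: "p \<in> Lh2" "\<And>z. z \<in> disc \<Longrightarrow> p z = (\<Sum>j\<le>n. \<Sum>k\<le>n. c j k * of_real (Re z) ^ j * of_real (Im z) ^ k)"
    using assms(1) unfolding harmonic_polys_def by blast
  obtain m d where q: "q \<in> Lh2" "\<And>z. z \<in> disc \<Longrightarrow> q z = (\<Sum>j\<le>m. \<Sum>k\<le>m. d j k * of_real (Re z) ^ j * of_real (Im z) ^ k)"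
    using assms(2) unfolding harmonic_polys_def by blast
  define ext where "ext l e j k = (if j \<le> l \<and> k \<le> l then e j k else (0::complex))" for l :: nat and e j k
  have ext: "(\<Sum>j\<le>l. \<Sum>k\<le>l. e j k * x ^ j * y ^ k) = (\<Sum>j\<le>max n m. \<Sum>k\<le>max n m. ext l e j k * x ^ j * y ^ k)"
    if "l \<le> max n m" for l e x y
  proof -
    have "(\<Sum>j\<le>l. \<Sum>k\<le>l. e j k * x ^ j * y ^ k) = (\<Sum>j\<le>l. \<Sum>k\<le>max n m. ext l e j k * x ^ j * y ^ k)"
      using that by (intro sum.cong refl sum.mono_neutral_cong_left) (auto simp: ext_def)
    also have "\<dots> = (\<Sum>j\<le>max n m. \<Sum>k\<le>max n m. ext l e j k * x ^ j * y ^ k)"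
      using that by (intro sum.mono_neutral_left) (auto simp: ext_def)
    finally show ?thesis .
  qed
  have "\<forall>z\<in>disc. (p - q) z = (\<Sum>j\<le>max n m. \<Sum>k\<le>max n m. (ext n c j k - ext m d j k) * of_real (Re z) ^ j * of_real (Im z) ^ k)"
    using ext[of n c] ext[of m d] by (simp add: p q fun_diff_def sum_subtractf left_diff_distrib)
  then show ?thesis unfolding harmonic_polys_def
    by (intro CollectI conjI diff_Lh2[OF p(1) q(1)] exI)
qed

lemma harmonic_polys_Lh2: "p \<in> harmonic_polys \<Longrightarrow> p \<in> Lh2"
  by (simp add: harmonic_polys_def)

lemma harmonic_polys_bounded:
  assumes "p \<in> harmonic_polys"
  obtains B where "\<And>z. z \<in> disc \<Longrightarrow> cmod (p z) \<le> B"
proof -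
  obtain n c where p: "\<And>z. z \<in> disc \<Longrightarrow> p z = (\<Sum>j\<le>n. \<Sum>k\<le>n. c j k * of_real (Re z) ^ j * of_real (Im z) ^ k)"
    using assms(1) unfolding harmonic_polys_def by blast
  show ?thesis
  proof
    fix z assume z: "z \<in> disc"
    then have "\<bar>Re z\<bar> \<le> 1" "\<bar>Im z\<bar> \<le> 1"
      using abs_Re_le_cmod[of z] abs_Im_le_cmod[of z] by auto
    then have "cmod (c j k * of_real (Re z) ^ j * of_real (Im z) ^ k) \<le> cmod (c j k)" for j k
      by (simp add: norm_mult norm_power mult_le_one power_le_one mult.assoc mult_left_le)
    then show "cmod (p z) \<le> (\<Sum>j\<le>n. \<Sum>k\<le>n. cmod (c j k))"
      unfolding p[OF z] by (intro sum_norm_le)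
  qed
qed

lemma integrable_times_bounded:
  assumes \<psi>: "integrable dA \<psi>" and k: "k \<in> borel_measurable dA" "\<And>w. w \<in> disc \<Longrightarrow> cmod (k w) \<le> B"
  shows "integrable dA (\<lambda>w. k w * \<psi> w :: complex)"
proof (rule Bochner_Integration.integrable_bound)
  show "integrable dA (\<lambda>w. B * cmod (\<psi> w))"
    using \<psi> by (intro integrable_mult_right integrable_norm)
  show "(\<lambda>w. k w * \<psi> w) \<in> borel_measurable dA"
    using \<psi> k(1) by (intro borel_measurable_times) auto
  show "AE w in dA. norm (k w * \<psi> w) \<le> norm (B * cmod (\<psi> w))"
  proof (rule AE_I2)
    fix w assume "w \<in> space dA"
    then have "cmod (k w) * cmod (\<psi> w) \<le> B * cmod (\<psi> w)" using k(2) by (intro mult_right_mono) auto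
    then show "norm (k w * \<psi> w) \<le> norm (B * cmod (\<psi> w))" by (simp add: norm_mult)
  qed
qed

lemma integrable_times_harmonic_poly:
  assumes "integrable dA u" "p \<in> harmonic_polys"
  shows "integrable dA (\<lambda>w. u w * p w)"
proof -
  obtain B where "\<And>z. z \<in> disc \<Longrightarrow> cmod (p z) \<le> B" using harmonic_polys_bounded[OF assms(2)] by metis
  from integrable_times_bounded[OF assms(1) Lh2_measurable[OF harmonic_polys_Lh2[OF assms(2)]] this]
  show ?thesis by (simp add: mult.commute)
qed

section \<open>Completeness\<close>

lemma sum_weight_le: "weight a b sums S \<Longrightarrow> finite I \<Longrightarrow> sum (weight a b) I \<le> S"
  by (metis sum_le_suminf sums_iff weight_nonneg)

text \<open>The coefficients of a Cauchy sequence are Cauchy. Letting \<open>m\<close> tend to infinity in the partial sums of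
  \<open>\<parallel>g\<^sub>n - g\<^sub>m\<parallel>\<^sup>2\<close> bounds the Parseval sum of the coefficients of \<open>g\<^sub>n\<close> minus the limit coefficients. For one
  fixed index this difference is therefore realized by a function \<open>d\<close> in \<open>Lh2\<close>, and the limit is that member
  of the sequence minus \<open>d\<close>.\<close>

lemma Lh2_complete:
  fixes g :: "nat \<Rightarrow> complex \<Rightarrow> complex"
  assumes g: "\<And>n. g n \<in> Lh2"
    and cauchy: "\<And>e. e > 0 \<Longrightarrow> \<exists>N. \<forall>n\<ge>N. \<forall>m\<ge>N. norm2 (g n - g m) \<le> e"
  obtains h where "h \<in> Lh2" "(\<lambda>n. norm2 (g n - h)) \<longlonglongrightarrow> 0"
proof -
  have "\<exists>a b. harm_series (g n) a b" for n using Lh2_series[OF g] by metis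
  then obtain A B where s: "\<And>n. harm_series (g n) (A n) (B n)" by metis
  define W where "W n m = weight (\<lambda>k. A n k - A m k) (\<lambda>k. B n k - B m k)" for n m
  have W: "W n m sums (norm2 (g n - g m))\<^sup>2" for n m
    unfolding W_def by (rule parseval[OF diff_Lh2[OF g g] harm_series_diff[OF s s]])
  have coef: "(cmod (A n k - A m k))\<^sup>2 \<le> real (Suc k) * (norm2 (g n - g m))\<^sup>2 \<and>
      (cmod (B n k - B m k))\<^sup>2 \<le> real (Suc k) * (norm2 (g n - g m))\<^sup>2" for n m k
  proof -
    have "W n m k \<le> (norm2 (g n - g m))\<^sup>2"
      using sum_weight_le[OF W[unfolded W_def], of "{k}"] by (simp add: W_def)
    then have "(cmod (A n k - A m k))\<^sup>2 + (cmod (B n k - B m k))\<^sup>2 \<le> real (Suc k) * (norm2 (g n - g m))\<^sup>2"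
      by (simp add: W_def weight_def divide_le_eq mult.commute add.commute)
    then show ?thesis
      using zero_le_power2[of "cmod (A n k - A m k)"] zero_le_power2[of "cmod (B n k - B m k)"] by linarith
  qed
  have coef_cauchy: "Cauchy (\<lambda>n. X n k)"
    if X: "\<And>n m. (cmod (X n k - X m k))\<^sup>2 \<le> real (Suc k) * (norm2 (g n - g m))\<^sup>2" for X :: "nat \<Rightarrow> nat \<Rightarrow> complex" and k
  proof (rule CauchyI)
    fix e :: real assume e: "e > 0"
    define e' where "e' = e / (2 * sqrt (real (Suc k)))"
    have "e' > 0" unfolding e'_def using e by simp
    then obtain N where N: "\<And>n m. n \<ge> N \<Longrightarrow> m \<ge> N \<Longrightarrow> norm2 (g n - g m) \<le> e'" using cauchy by blast
    have "cmod (X n k - X m k) < e" if "n \<ge> N" "m \<ge> N" for n m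
    proof -
      have "cmod (X n k - X m k) \<le> sqrt (real (Suc k)) * norm2 (g n - g m)"
      proof (rule power2_le_imp_le)
        show "(cmod (X n k - X m k))\<^sup>2 \<le> (sqrt (real (Suc k)) * norm2 (g n - g m))\<^sup>2"
          unfolding power_mult_distrib using X[of n m] by (simp del: of_nat_Suc)
      qed simp
      also have "\<dots> \<le> sqrt (real (Suc k)) * e'" using N[OF that] by (intro mult_left_mono) auto
      also have "\<dots> = e / 2" by (simp add: e'_def del: of_nat_Suc)
      finally show ?thesis using e by simp
    qed
    then show "\<exists>N. \<forall>m\<ge>N. \<forall>n\<ge>N. norm (X m k - X n k) < e" by (intro exI[of _ N]) simp
  qed
  define a b where "a k = lim (\<lambda>n. A n k)" and "b k = lim (\<lambda>n. B n k)" for k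
  have a: "(\<lambda>n. A n k) \<longlonglongrightarrow> a k" and b: "(\<lambda>n. B n k) \<longlonglongrightarrow> b k" for k
  proof -
    have "Cauchy (\<lambda>n. A n k)" "Cauchy (\<lambda>n. B n k)"
      by (rule coef_cauchy[of A k, OF conjunct1[OF coef]], rule coef_cauchy[of B k, OF conjunct2[OF coef]])
    then show "(\<lambda>n. A n k) \<longlonglongrightarrow> a k" "(\<lambda>n. B n k) \<longlonglongrightarrow> b k"
      unfolding a_def b_def Cauchy_convergent_iff convergent_LIMSEQ_iff by auto
  qed
  have b0: "b 0 = 0"
  proof -
    have "(\<lambda>n. B n 0) = (\<lambda>n. 0)" using s by (simp add: harm_series_def)
    then show ?thesis using LIMSEQ_unique[OF b[of 0]] by simp
  qed
  have tail: "summable (weight (\<lambda>k. A n k - a k) (\<lambda>k. B n k - b k)) \<and>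
      (\<Sum>k. weight (\<lambda>k. A n k - a k) (\<lambda>k. B n k - b k) k) \<le> e\<^sup>2"
    if N: "\<And>m. m \<ge> N \<Longrightarrow> norm2 (g n - g m) \<le> e" and e: "e > 0" for n N e
  proof -
    have fin: "(\<Sum>k<K. weight (\<lambda>k. A n k - a k) (\<lambda>k. B n k - b k) k) \<le> e\<^sup>2" for K
    proof (rule LIMSEQ_le_const2)
      show "(\<lambda>m. \<Sum>k<K. W n m k) \<longlonglongrightarrow> (\<Sum>k<K. weight (\<lambda>k. A n k - a k) (\<lambda>k. B n k - b k) k)"
        unfolding W_def weight_def
        by (intro tendsto_sum tendsto_divide tendsto_add tendsto_power tendsto_norm tendsto_diff tendsto_const a b) auto
      show "\<exists>N. \<forall>m\<ge>N. (\<Sum>k<K. W n m k) \<le> e\<^sup>2"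
      proof (intro exI allI impI)
        fix m assume m: "m \<ge> N"
        have "(\<Sum>k<K. W n m k) \<le> (norm2 (g n - g m))\<^sup>2"
          unfolding W_def by (rule sum_weight_le[OF W[unfolded W_def]]) simp
        also have "\<dots> \<le> e\<^sup>2" using N[OF m] by (intro power_mono) auto
        finally show "(\<Sum>k<K. W n m k) \<le> e\<^sup>2" .
      qed
    qed
    have sm: "summable (weight (\<lambda>k. A n k - a k) (\<lambda>k. B n k - b k))"
    proof (rule bounded_imp_summable[where B = "e\<^sup>2"])
      show "(\<Sum>k\<le>K. weight (\<lambda>k. A n k - a k) (\<lambda>k. B n k - b k) k) \<le> e\<^sup>2" for K
        using fin[of "Suc K"] by (simp add: lessThan_Suc_atMost)
    qed simp
    then show ?thesis using suminf_le_const[OF sm fin] by simp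
  qed
  obtain N1 where "\<And>n m. n \<ge> N1 \<Longrightarrow> m \<ge> N1 \<Longrightarrow> norm2 (g n - g m) \<le> 1" using cauchy[OF zero_less_one] by blast
  then have t1: "summable (weight (\<lambda>k. A N1 k - a k) (\<lambda>k. B N1 k - b k))" using tail[of N1 N1 1] by simp
  have d0: "B N1 0 - b 0 = 0" using s b0 by (simp add: harm_series_def)
  define d where "d = harm_fun (\<lambda>k. A N1 k - a k) (\<lambda>k. B N1 k - b k)"
  have d: "harm_series d (\<lambda>k. A N1 k - a k) (\<lambda>k. B N1 k - b k)" "d \<in> Lh2"
    unfolding d_def using harm_fun_Lh2[of "\<lambda>k. B N1 k - b k", OF d0 t1] by auto
  define h where "h = g N1 - d"
  have hL: "h \<in> Lh2" unfolding h_def by (rule diff_Lh2[OF g d(2)])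
  have hs: "harm_series h a b"
    unfolding h_def using harm_series_diff[OF s[of N1] d(1)] by simp
  have "(\<lambda>n. norm2 (g n - h)) \<longlonglongrightarrow> 0"
  proof (rule LIMSEQ_I)
    fix r :: real assume r: "r > 0"
    obtain N where N: "\<And>n m. n \<ge> N \<Longrightarrow> m \<ge> N \<Longrightarrow> norm2 (g n - g m) \<le> r / 2" using cauchy[OF half_gt_zero[OF r]] by blast
    have "norm2 (g n - h) < r" if n: "n \<ge> N" for n
    proof -
      have "(norm2 (g n - h))\<^sup>2 = (\<Sum>k. weight (\<lambda>k. A n k - a k) (\<lambda>k. B n k - b k) k)"
        using parseval[OF diff_Lh2[OF g hL] harm_series_diff[OF s hs]] by (simp add: sums_iff)
      also have "\<dots> \<le> (r / 2)\<^sup>2" using tail[of N n "r / 2"] N[OF n] r by simp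
      finally have "norm2 (g n - h) \<le> r / 2" by (rule power2_le_imp_le) (use r in simp)
      then show ?thesis using r by simp
    qed
    then show "\<exists>no. \<forall>n\<ge>no. norm (norm2 (g n - h) - 0) < r" by (intro exI[of _ N]) simp
  qed
  then show ?thesis by (rule that[OF hL])
qed

section \<open>The projection in terms of coefficients\<close>

definition Q_coeff :: "(complex \<Rightarrow> complex) \<Rightarrow> nat \<Rightarrow> complex" where
  "Q_coeff \<psi> n = of_nat (Suc n) * (LINT w|dA. cnj w ^ n * \<psi> w)"

definition Q_cnj_coeff :: "(complex \<Rightarrow> complex) \<Rightarrow> nat \<Rightarrow> complex" where
  "Q_cnj_coeff \<psi> n = (if n = 0 then 0 else of_nat (Suc n) * (LINT w|dA. w ^ n * \<psi> w))"

lemma integrable_power_times: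
  assumes "integrable dA \<psi>"
  shows "integrable dA (\<lambda>w. w ^ n * \<psi> w)" "integrable dA (\<lambda>w. cnj w ^ n * \<psi> w)"
  by (intro integrable_times_bounded[OF assms, where B = 1] borel_measurable_dA_continuous continuous_intros;
      simp add: norm_power power_le_one)+

text \<open>The kernel is a derivative of a geometric series, which for fixed \<open>z\<close> in the disc converges uniformly
  in \<open>w\<close>; so the integral may be taken termwise. The summand \<open>- 1\<close> removes the constant that the two
  halves of the kernel would count twice, in accordance with \<open>Q_cnj_coeff \<psi> 0 = 0\<close>.\<close>

lemma Q_sums:
  assumes \<psi>: "integrable dA \<psi>" and z: "z \<in> disc"
  shows "(\<lambda>n. hterm (Q_coeff \<psi>) (Q_cnj_coeff \<psi>) n z) sums Q \<psi> z"
proof -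
  define k where "k n w = of_nat (Suc n) * (z * cnj w) ^ n + of_nat (Suc n) * (cnj z * w) ^ n - (if n = 0 then 1 else 0)" for n w
  define K where "K w = 1 / (1 - z * cnj w)\<^sup>2 + 1 / (1 - cnj z * w)\<^sup>2 - 1" for w
  have k_sums: "(\<lambda>n. k n w) sums K w" if "w \<in> disc" for w
  proof -
    have "cmod z * cmod w < 1"
      using z that mult_strict_mono'[of "cmod z" 1 "cmod w" 1] by simp
    then show ?thesis unfolding k_def K_def
      by (intro sums_add sums_diff geometric_deriv_sums sums_single[of 0 "\<lambda>_. 1"]) (auto simp: norm_mult)
  qed
  have k_bound: "cmod (k n w) \<le> 2 * (real (Suc n) * cmod z ^ n)" if w: "w \<in> disc" for n w
  proof (cases "n = 0")
    case False
    have "cmod z * cmod w \<le> cmod z" using w by (simp add: mult_left_le)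
    then have "(cmod z * cmod w) ^ n \<le> cmod z ^ n" by (intro power_mono) auto
    then have le: "real (Suc n) * (cmod z * cmod w) ^ n \<le> real (Suc n) * cmod z ^ n" by (intro mult_left_mono) auto
    have "cmod (k n w) \<le> cmod (of_nat (Suc n) * (z * cnj w) ^ n) + cmod (of_nat (Suc n) * (cnj z * w) ^ n)"
      unfolding k_def using False norm_triangle_ineq by simp
    also have "\<dots> = real (Suc n) * (cmod z * cmod w) ^ n + real (Suc n) * (cmod z * cmod w) ^ n"
      by (simp only: norm_mult norm_power norm_of_nat complex_mod_cnj)
    finally show ?thesis using le by linarith
  qed (simp add: k_def)
  have k_meas: "(\<lambda>w. k n w) \<in> borel_measurable dA" for n
    unfolding k_def by (intro borel_measurable_dA_continuous continuous_intros)
  define f where "f n w = k n w * \<psi> w" for n w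
  have f_int: "integrable dA (f n)" for n
    unfolding f_def by (rule integrable_times_bounded[OF \<psi> k_meas k_bound])
  have f_bound: "norm (f n w) \<le> cmod (\<psi> w) * (2 * (real (Suc n) * cmod z ^ n))" if "w \<in> disc" for n w
    unfolding f_def using mult_right_mono[OF k_bound[OF that, of n], of "cmod (\<psi> w)"]
    by (simp add: norm_mult mult.commute)
  have geo: "summable (\<lambda>n. C * (2 * (real (Suc n) * cmod z ^ n)))" for C
    using z by (intro summable_mult summable_Suc_power[of _ 2, simplified mult.assoc]) auto
  have "(\<lambda>n. LINT w|dA. f n w) sums (LINT w|dA. (\<Sum>n. f n w))"
  proof (rule sums_integral[OF f_int])
    show "AE w in dA. summable (\<lambda>n. norm (f n w))"
    proof (rule AE_I2)
      fix w assume "w \<in> space dA"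
      then show "summable (\<lambda>n. norm (f n w))"
        using f_bound by (intro summable_comparison_test[OF _ geo[of "cmod (\<psi> w)"]]) auto
    qed
    show "summable (\<lambda>n. LINT w|dA. norm (f n w))"
    proof (rule summable_comparison_test[OF _ geo[of "LINT w|dA. cmod (\<psi> w)"]], intro exI allI impI)
      fix n :: nat
      have "(LINT w|dA. norm (f n w)) \<le> (LINT w|dA. cmod (\<psi> w) * (2 * (real (Suc n) * cmod z ^ n)))"
        by (intro integral_mono integrable_norm f_int integrable_mult_left \<psi>) (use f_bound in auto)
      also have "\<dots> = (LINT w|dA. cmod (\<psi> w)) * (2 * (real (Suc n) * cmod z ^ n))"
        by (rule integral_mult_left_zero)
      finally show "norm (LINT w|dA. norm (f n w)) \<le> (LINT w|dA. cmod (\<psi> w)) * (2 * (real (Suc n) * cmod z ^ n))"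
        by (simp add: integral_nonneg_AE)
    qed
  qed
  also have "(LINT w|dA. (\<Sum>n. f n w)) = Q \<psi> z"
  proof -
    have "(LINT w|dA. (\<Sum>n. f n w)) = (LINT w|dA. K w * \<psi> w)"
      by (intro Bochner_Integration.integral_cong refl sums_unique[symmetric])
         (auto simp: f_def intro!: sums_mult2 k_sums)
    then show ?thesis using z by (simp add: Q_def K_def)
  qed
  also have "(\<lambda>n. LINT w|dA. f n w) = (\<lambda>n. hterm (Q_coeff \<psi>) (Q_cnj_coeff \<psi>) n z)"
  proof
    fix n
    note int = integrable_power_times[OF \<psi>, of n]
    show "(LINT w|dA. f n w) = hterm (Q_coeff \<psi>) (Q_cnj_coeff \<psi>) n z"
    proof (cases "n = 0")
      case True
      then show ?thesis by (simp add: f_def k_def hterm_def Q_coeff_def Q_cnj_coeff_def)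
    next
      case False
      have "f n w = (z ^ n * of_nat (Suc n)) * (cnj w ^ n * \<psi> w) + (cnj z ^ n * of_nat (Suc n)) * (w ^ n * \<psi> w)" for w
        using False unfolding f_def k_def power_mult_distrib by (simp add: algebra_simps del: of_nat_Suc)
      then have "(LINT w|dA. f n w) = (z ^ n * of_nat (Suc n)) * (LINT w|dA. cnj w ^ n * \<psi> w)
          + (cnj z ^ n * of_nat (Suc n)) * (LINT w|dA. w ^ n * \<psi> w)"
        using int by (simp del: of_nat_Suc)
      then show ?thesis using False by (simp add: hterm_def Q_coeff_def Q_cnj_coeff_def mult_ac del: of_nat_Suc)
    qed
  qed
  finally show ?thesis .
qed

lemma Q_eq_harm_fun:
  assumes "integrable dA \<psi>"
  shows "Q \<psi> = harm_fun (Q_coeff \<psi>) (Q_cnj_coeff \<psi>)"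
proof
  fix z
  show "Q \<psi> z = harm_fun (Q_coeff \<psi>) (Q_cnj_coeff \<psi>) z"
    using sums_unique[OF Q_sums[OF assms]] by (cases "z \<in> disc") (auto simp: harm_fun_def Q_def)
qed

lemma Q_series:
  assumes \<psi>: "integrable dA \<psi>"
  shows "harm_series (Q \<psi>) (Q_coeff \<psi>) (Q_cnj_coeff \<psi>)"
  unfolding Q_eq_harm_fun[OF \<psi>]
proof (rule harm_fun_series_of_linear_bound)
  define K where "K = (LINT w|dA. cmod (\<psi> w))"
  have K0: "K \<ge> 0" unfolding K_def by (simp add: integral_nonneg_AE)
  have le: "cmod (LINT w|dA. m w ^ n * \<psi> w) \<le> K"
    if m: "\<And>w. cmod (m w) = cmod w" and int: "integrable dA (\<lambda>w. m w ^ n * \<psi> w)" for m n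
  proof -
    have "cmod (LINT w|dA. m w ^ n * \<psi> w) \<le> (LINT w|dA. cmod (m w ^ n * \<psi> w))" by (rule integral_norm_bound)
    also have "\<dots> \<le> K" unfolding K_def
      by (intro integral_mono integrable_norm int \<psi>)
         (simp add: norm_mult norm_power m power_le_one mult_left_le_one_le)
    finally show ?thesis .
  qed
  show "cmod (Q_coeff \<psi> n) \<le> K * real (Suc n)" for n
    using mult_left_mono[OF le[of cnj n], of "real (Suc n)"] integrable_power_times[OF \<psi>]
    by (simp add: Q_coeff_def norm_mult mult.commute del: of_nat_Suc)
  show "cmod (Q_cnj_coeff \<psi> n) \<le> K * real (Suc n)" for n
    using mult_left_mono[OF le[of "\<lambda>w. w" n], of "real (Suc n)"] integrable_power_times[OF \<psi>] K0
    by (simp add: Q_cnj_coeff_def norm_mult mult.commute del: of_nat_Suc)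
qed (simp add: Q_cnj_coeff_def)

lemma Q_diff:
  assumes "integrable dA \<psi>" "integrable dA \<phi>"
  shows "Q (\<lambda>w. \<psi> w - \<phi> w) = Q \<psi> - Q \<phi>"
proof
  fix z
  show "Q (\<lambda>w. \<psi> w - \<phi> w) z = (Q \<psi> - Q \<phi>) z"
  proof (cases "z \<in> disc")
    case True
    have "Q_coeff (\<lambda>w. \<psi> w - \<phi> w) n = Q_coeff \<psi> n - Q_coeff \<phi> n" "Q_cnj_coeff (\<lambda>w. \<psi> w - \<phi> w) n = Q_cnj_coeff \<psi> n - Q_cnj_coeff \<phi> n" for n
      using integrable_power_times[OF assms(1), of n] integrable_power_times[OF assms(2), of n]
      by (simp_all add: Q_coeff_def Q_cnj_coeff_def right_diff_distrib del: of_nat_Suc)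
    then have "hterm (Q_coeff (\<lambda>w. \<psi> w - \<phi> w)) (Q_cnj_coeff (\<lambda>w. \<psi> w - \<phi> w)) n z = hterm (Q_coeff \<psi>) (Q_cnj_coeff \<psi>) n z - hterm (Q_coeff \<phi>) (Q_cnj_coeff \<phi>) n z" for n
      unfolding hterm_def by (simp only: left_diff_distrib) simp
    then show ?thesis
      using sums_diff[OF Q_sums[OF assms(1) True] Q_sums[OF assms(2) True]]
        Q_sums[OF Bochner_Integration.integrable_diff[OF assms] True] sums_unique2 by (fastforce simp: fun_diff_def)
  qed (simp add: Q_def fun_diff_def)
qed


text \<open>Pairing with the conjugate monomial, whose expansion has a single nonzero term. For \<open>m = 0\<close> the
  conjugate of a constant must again be put into the first coefficient, whence the case distinction.\<close>

lemma integral_Lh2_monomial: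
  assumes g: "g \<in> Lh2" "harm_series g a b" and d: "m = 0 \<Longrightarrow> d = 0"
  shows "(LINT z|dA. g z * (c * z ^ m + d * cnj z ^ m))
    = (if m = 0 then a 0 * c else (a m * d + b m * c) / complex_of_real (real m + 1))"
proof -
  \<comment> \<open>the coefficients of the conjugate of \<open>c * z ^ m + d * cnj z ^ m\<close>\<close>
  define c' d' where "c' = (if m = 0 then cnj c else cnj d)" and "d' = (if m = 0 then 0 else cnj c)"
  define \<alpha> \<beta> where "\<alpha> n = (if n = m then c' else 0)" and "\<beta> n = (if n = m then d' else 0)" for n
  have \<beta>0: "\<beta> 0 = 0" by (simp add: \<beta>_def d'_def)
  define h where "h = disc_poly \<alpha> \<beta> (Suc m)"
  have hL: "h \<in> Lh2" and hs: "harm_series h (truncate (Suc m) \<alpha>) (truncate (Suc m) \<beta>)"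
    unfolding h_def using disc_poly_Lh2[of \<beta>, OF \<beta>0] by auto
  have hz: "cnj (h z) = c * z ^ m + d * cnj z ^ m" if "z \<in> disc" for z
  proof -
    have "h z = (\<Sum>n<Suc m. if n = m then hterm \<alpha> \<beta> m z else 0)"
      unfolding h_def disc_poly_def using that by (auto intro!: sum.cong simp: hterm_def \<alpha>_def \<beta>_def)
    then have "h z = c' * z ^ m + d' * cnj z ^ m"
      by (simp add: hterm_def \<alpha>_def \<beta>_def)
    then show ?thesis using d by (auto simp: c'_def d'_def)
  qed
  have "(LINT z|dA. g z * (c * z ^ m + d * cnj z ^ m)) = ip g h"
    unfolding ip_def by (intro Bochner_Integration.integral_cong refl) (simp add: hz)
  also have "\<dots> = (a m * cnj (truncate (Suc m) \<alpha> m) + b m * cnj (truncate (Suc m) \<beta> m)) / complex_of_real (real m + 1)"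
    by (rule ip_single_term[OF g hL hs]) (auto simp: truncate_def \<alpha>_def \<beta>_def)
  finally show ?thesis by (auto simp: truncate_def \<alpha>_def \<beta>_def c'_def d'_def)
qed

text \<open>The factor \<open>n + 1\<close> in the coefficients of \<open>Q \<psi>\<close> cancels the square norm \<open>1 / (n + 1)\<close> of the monomial.\<close>

lemma bilin_Q_disc_poly:
  assumes \<psi>: "integrable dA \<psi>" and Q: "Q \<psi> \<in> Lh2" and d0: "d 0 = 0"
  shows "bilin (Q \<psi>) (disc_poly c d N) = bilin \<psi> (disc_poly c d N)"
proof -
  note int = integrable_power_times[OF \<psi>]
  have single: "(LINT z|dA. Q \<psi> z * hterm c d m z) = (LINT z|dA. \<psi> z * hterm c d m z)" for m
  proof -
    have "(LINT z|dA. Q \<psi> z * hterm c d m z)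
        = (if m = 0 then Q_coeff \<psi> 0 * c m else (Q_coeff \<psi> m * d m + Q_cnj_coeff \<psi> m * c m) / complex_of_real (real m + 1))"
      unfolding hterm_def using d0 by (intro integral_Lh2_monomial[OF Q Q_series[OF \<psi>]]) simp
    also have "\<dots> = c m * (LINT w|dA. w ^ m * \<psi> w) + d m * (LINT w|dA. cnj w ^ m * \<psi> w)"
    proof (cases "m = 0")
      case False
      have nz: "(1 + of_nat m :: complex) \<noteq> 0" by (metis of_nat_Suc of_nat_neq_0)
      have "complex_of_real (real m + 1) = of_nat (Suc m)" by simp
      then show ?thesis using False nz by (simp add: Q_coeff_def Q_cnj_coeff_def field_simps)
    qed (simp add: Q_coeff_def d0)
    also have "\<dots> = (LINT w|dA. c m * (w ^ m * \<psi> w) + d m * (cnj w ^ m * \<psi> w))"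
      using int by simp
    also have "\<dots> = (LINT w|dA. \<psi> w * hterm c d m w)"
      by (intro Bochner_Integration.integral_cong refl) (simp add: hterm_def algebra_simps)
    finally show ?thesis .
  qed
  have sum: "bilin k (disc_poly c d N) = (\<Sum>m<N. LINT z|dA. k z * hterm c d m z)"
    if "\<And>m. integrable dA (\<lambda>z. k z * hterm c d m z)" for k
  proof -
    have "bilin k (disc_poly c d N) = (LINT z|dA. (\<Sum>m<N. k z * hterm c d m z))"
      unfolding bilin_def
      by (intro Bochner_Integration.integral_cong refl) (simp add: disc_poly_def sum_distrib_left)
    also have "\<dots> = (\<Sum>m<N. LINT z|dA. k z * hterm c d m z)"
      by (rule Bochner_Integration.integral_sum) (rule that)
    finally show ?thesis .
  qed
  have int1: "integrable dA (\<lambda>z. \<psi> z * hterm c d m z)" for m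
  proof -
    have "integrable dA (\<lambda>w. c m * (w ^ m * \<psi> w) + d m * (cnj w ^ m * \<psi> w))"
      using int by (intro Bochner_Integration.integrable_add integrable_mult_right)
    then show ?thesis by (simp add: hterm_def algebra_simps)
  qed
  \<comment> \<open>\<open>hterm c d m\<close> is, on the disc, a difference of two functions from \<open>Lh2\<close>\<close>
  have int2: "integrable dA (\<lambda>z. Q \<psi> z * hterm c d m z)" for m
  proof -
    have "integrable dA (\<lambda>z. Q \<psi> z * (disc_poly c d (Suc m) - disc_poly c d m) z)"
      using d0 by (intro integrable_mult_Lh2 Q diff_Lh2 disc_poly_Lh2(2))
    moreover have "integrable dA (\<lambda>z. Q \<psi> z * (disc_poly c d (Suc m) - disc_poly c d m) z)
        \<longleftrightarrow> integrable dA (\<lambda>z. Q \<psi> z * hterm c d m z)"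
      by (intro Bochner_Integration.integrable_cong refl) (simp add: disc_poly_def)
    ultimately show ?thesis by blast
  qed
  show ?thesis unfolding sum[OF int1] sum[OF int2] by (intro sum.cong refl single)
qed

section \<open>Toeplitz operators and their symmetry\<close>

lemma bilin_tendsto:
  assumes g: "\<And>n. gs n \<in> Lh2" "g \<in> Lh2" "(\<lambda>n. norm2 (gs n - g)) \<longlonglongrightarrow> 0"
    and h: "\<And>n. hs n \<in> Lh2" "h \<in> Lh2" "(\<lambda>n. norm2 (hs n - h)) \<longlonglongrightarrow> 0"
  shows "(\<lambda>n. bilin (gs n) (hs n)) \<longlonglongrightarrow> bilin g h"
proof (rule LIM_zero_cancel, rule Lim_null_comparison)
  have bound: "cmod (bilin (gs n) (hs n) - bilin g h)
      \<le> norm2 (gs n - g) * (norm2 (hs n - h) + norm2 h) + norm2 g * norm2 (hs n - h)" for n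
  proof -
    have d: "gs n - g \<in> Lh2" "hs n - h \<in> Lh2"
      by (rule diff_Lh2[OF g(1,2)], rule diff_Lh2[OF h(1,2)])
    have eq: "bilin (gs n) (hs n) - bilin g h = bilin (gs n - g) (hs n) + bilin g (hs n - h)"
      by (simp only: bilin_diff_left[OF g(1,2) h(1)] bilin_diff_right[OF h(1,2) g(2)]) simp
    have "cmod (bilin (gs n) (hs n) - bilin g h) \<le> norm2 (gs n - g) * norm2 (hs n) + norm2 g * norm2 (hs n - h)"
      unfolding eq by (rule norm_triangle_le[OF add_mono[OF bilin_Cauchy_Schwarz[OF d(1) h(1)] bilin_Cauchy_Schwarz[OF g(2) d(2)]]])
    also have "\<dots> \<le> norm2 (gs n - g) * (norm2 (hs n - h) + norm2 h) + norm2 g * norm2 (hs n - h)"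
    proof -
      have "norm2 (hs n) \<le> norm2 (hs n - h) + norm2 h"
        using norm2_triangle[OF d(2) h(2)] unfolding diff_add_cancel .
      then show ?thesis by (rule add_right_mono[OF mult_left_mono[OF _ norm2_nonneg]])
    qed
    finally show ?thesis .
  qed
  show "\<forall>\<^sub>F n in sequentially. norm (bilin (gs n) (hs n) - bilin g h)
      \<le> norm2 (gs n - g) * (norm2 (hs n - h) + norm2 h) + norm2 g * norm2 (hs n - h)"
    by (intro always_eventually allI bound)
  have "(\<lambda>n. norm2 (gs n - g) * (norm2 (hs n - h) + norm2 h) + norm2 g * norm2 (hs n - h))
      \<longlonglongrightarrow> 0 * (0 + norm2 h) + norm2 g * 0"
    by (intro tendsto_add tendsto_mult tendsto_const g(3) h(3))
  then show "(\<lambda>n. norm2 (gs n - g) * (norm2 (hs n - h) + norm2 h) + norm2 g * norm2 (hs n - h)) \<longlonglongrightarrow> 0"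
    by (simp only: mult_zero_left mult_zero_right add_0_left)
qed

text \<open>The bound in the definition of a T-function, restated as a Lipschitz estimate by the linearity of \<open>Q\<close>.\<close>

lemma T_function_bound:
  assumes "T_function u"
  obtains C where "C \<ge> 0"
    "\<And>p. p \<in> harmonic_polys \<Longrightarrow> Q (\<lambda>w. u w * p w) \<in> Lh2"
    "\<And>p q. p \<in> harmonic_polys \<Longrightarrow> q \<in> harmonic_polys \<Longrightarrow>
        norm2 (Q (\<lambda>w. u w * p w) - Q (\<lambda>w. u w * q w)) \<le> C * norm2 (p - q)"
proof -
  obtain C where u: "integrable dA u"
    and C: "\<And>p. p \<in> harmonic_polys \<Longrightarrow> Q (\<lambda>w. u w * p w) \<in> Lh2 \<and> norm2 (Q (\<lambda>w. u w * p w)) \<le> C * norm2 p"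
    using assms unfolding T_function_def by blast
  show ?thesis
  proof (rule that[of "max C 0"])
    fix p q assume p: "p \<in> harmonic_polys" and q: "q \<in> harmonic_polys"
    have "Q (\<lambda>w. u w * p w) - Q (\<lambda>w. u w * q w) = Q (\<lambda>w. u w * (p - q) w)"
      using Q_diff[OF integrable_times_harmonic_poly[OF u p] integrable_times_harmonic_poly[OF u q]]
      by (simp add: right_diff_distrib fun_diff_def)
    then have "norm2 (Q (\<lambda>w. u w * p w) - Q (\<lambda>w. u w * q w)) \<le> C * norm2 (p - q)"
      using C[OF harmonic_polys_diff[OF p q]] by simp
    also have "\<dots> \<le> max C 0 * norm2 (p - q)" by (intro mult_right_mono) auto
    finally show "norm2 (Q (\<lambda>w. u w * p w) - Q (\<lambda>w. u w * q w)) \<le> max C 0 * norm2 (p - q)" .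
  qed (use C in auto)
qed

text \<open>The images of the truncated series of \<open>h\<close> form a Cauchy sequence, and by the Lipschitz estimate any
  other approximating sequence of harmonic polynomials has the same limit. That the truncations
  converge to \<open>h\<close> also makes the limit unique.\<close>

lemma toeplitz_works:
  assumes u: "T_function u" and h: "h \<in> Lh2"
  shows "toeplitz u h \<in> Lh2"
    and "\<And>p. (\<And>n. p n \<in> harmonic_polys) \<Longrightarrow> (\<lambda>n. norm2 (p n - h)) \<longlonglongrightarrow> 0 \<Longrightarrow>
      (\<lambda>n. norm2 (Q (\<lambda>w. u w * p n w) - toeplitz u h)) \<longlonglongrightarrow> 0"
proof -
  let ?S = "\<lambda>p. Q (\<lambda>w. u w * p w)"
  let ?P = "\<lambda>g. g \<in> Lh2 \<and>
     (\<forall>p. (\<forall>n. p n \<in> harmonic_polys) \<and> (\<lambda>n. norm2 (p n - h)) \<longlonglongrightarrow> 0 \<longrightarrow>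
          (\<lambda>n. norm2 (?S (p n) - g)) \<longlonglongrightarrow> 0)"
  obtain C where C0: "C \<ge> 0" and S: "\<And>p. p \<in> harmonic_polys \<Longrightarrow> ?S p \<in> Lh2"
    and C: "\<And>p q. p \<in> harmonic_polys \<Longrightarrow> q \<in> harmonic_polys \<Longrightarrow> norm2 (?S p - ?S q) \<le> C * norm2 (p - q)"
    by (rule T_function_bound[OF u]) blast
  obtain a b where s: "harm_series h a b" using Lh2_series[OF h] .
  have b0: "b 0 = 0" using s by (simp add: harm_series_def)
  define q where "q n = disc_poly a b n" for n
  have q: "q n \<in> harmonic_polys" for n unfolding q_def by (rule disc_poly_harmonic_polys[of b, OF b0])
  have qL: "q n \<in> Lh2" for n by (rule harmonic_polys_Lh2[OF q])
  have q_lim: "(\<lambda>n. norm2 (q n - h)) \<longlonglongrightarrow> 0" unfolding q_def by (rule disc_poly_tendsto[OF h s])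
  have cauchy: "\<exists>N. \<forall>n\<ge>N. \<forall>m\<ge>N. norm2 (?S (q n) - ?S (q m)) \<le> e" if e: "e > 0" for e
  proof -
    \<comment> \<open>\<open>C + 1\<close> rather than \<open>C\<close>, which may be \<open>0\<close>\<close>
    define \<delta> where "\<delta> = e / (2 * (C + 1))"
    have \<delta>: "\<delta> > 0" "C * (\<delta> + \<delta>) \<le> e" 
    proof -
      show pos: "\<delta> > 0" using e C0 by (simp add: \<delta>_def)
      have "C * (\<delta> + \<delta>) \<le> (C + 1) * (2 * \<delta>)" using pos by (simp add: algebra_simps)
      also have "\<dots> = e" using C0 by (simp add: \<delta>_def field_simps)
      finally show "C * (\<delta> + \<delta>) \<le> e" .
    qed
    obtain N where N: "\<And>n. n \<ge> N \<Longrightarrow> norm2 (q n - h) < \<delta>"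
      using order_tendstoD(2)[OF q_lim \<delta>(1)] unfolding eventually_sequentially by blast
    have "norm2 (?S (q n) - ?S (q m)) \<le> e" if nm: "n \<ge> N" "m \<ge> N" for n m
    proof -
      have "norm2 (q n - q m) \<le> norm2 (q n - h) + norm2 (h - q m)"
        by (rule norm2_triangle_diff[OF qL h qL])
      also have "\<dots> \<le> \<delta> + \<delta>" using N[OF nm(1)] N[OF nm(2)] by (simp add: norm2_minus_commute[of h])
      finally have "C * norm2 (q n - q m) \<le> C * (\<delta> + \<delta>)" using C0 by (rule mult_left_mono)
      then show ?thesis using C[OF q q, of n m] \<delta>(2) by linarith
    qed
    then show ?thesis by (intro exI[of _ N]) simp
  qed
  obtain g where g: "g \<in> Lh2" "(\<lambda>n. norm2 (?S (q n) - g)) \<longlonglongrightarrow> 0"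
    by (rule Lh2_complete[of "\<lambda>n. ?S (q n)", OF S[OF q] cauchy]) blast
  have Pg: "?P g"
  proof (intro conjI g(1) allI impI)
    fix p :: "nat \<Rightarrow> complex \<Rightarrow> complex"
    assume "(\<forall>n. p n \<in> harmonic_polys) \<and> (\<lambda>n. norm2 (p n - h)) \<longlonglongrightarrow> 0"
    then have p: "\<And>n. p n \<in> harmonic_polys" and p_lim: "(\<lambda>n. norm2 (p n - h)) \<longlonglongrightarrow> 0" by auto
    have bound: "norm2 (?S (p n) - g) \<le> C * (norm2 (p n - h) + norm2 (q n - h)) + norm2 (?S (q n) - g)" for n
    proof -
      have "norm2 (?S (p n) - g) \<le> norm2 (?S (p n) - ?S (q n)) + norm2 (?S (q n) - g)"
        by (rule norm2_triangle_diff[OF S[OF p] S[OF q] g(1)])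
      moreover have "norm2 (?S (p n) - ?S (q n)) \<le> C * norm2 (p n - q n)" by (rule C[OF p q])
      moreover have "norm2 (p n - q n) \<le> norm2 (p n - h) + norm2 (q n - h)"
        using norm2_triangle_diff[OF harmonic_polys_Lh2[OF p] h qL] by (simp add: norm2_minus_commute[of h])
      then have "C * norm2 (p n - q n) \<le> C * (norm2 (p n - h) + norm2 (q n - h))" using C0 by (rule mult_left_mono)
      ultimately show ?thesis by linarith
    qed
    have lim: "(\<lambda>n. C * (norm2 (p n - h) + norm2 (q n - h)) + norm2 (?S (q n) - g)) \<longlonglongrightarrow> C * (0 + 0) + 0"
      by (intro tendsto_add tendsto_mult tendsto_const p_lim q_lim g(2))
    show "(\<lambda>n. norm2 (?S (p n) - g)) \<longlonglongrightarrow> 0"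
    proof (rule Lim_null_comparison)
      show "\<forall>\<^sub>F n in sequentially. norm (norm2 (?S (p n) - g))
          \<le> C * (norm2 (p n - h) + norm2 (q n - h)) + norm2 (?S (q n) - g)"
        by (intro always_eventually allI) (simp only: real_norm_def abs_of_nonneg[OF norm2_nonneg] bound)
      show "(\<lambda>n. C * (norm2 (p n - h) + norm2 (q n - h)) + norm2 (?S (q n) - g)) \<longlonglongrightarrow> 0"
        using lim by (simp only: add_0_left mult_zero_right)
    qed
  qed
  have "?P (toeplitz u h)"
    unfolding toeplitz_def
  proof (rule theI[of ?P, OF Pg])
    fix g' assume P': "?P g'"
    have lim': "(\<lambda>n. norm2 (?S (q n) - g')) \<longlonglongrightarrow> 0" using P' q q_lim by blast
    have le: "norm2 (g - g') \<le> norm2 (?S (q n) - g) + norm2 (?S (q n) - g')" for n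
      using norm2_triangle_diff[OF g(1) S[OF q] conjunct1[OF P'], of n] by (simp add: norm2_minus_commute[of g])
    have "(\<lambda>n. norm2 (?S (q n) - g) + norm2 (?S (q n) - g')) \<longlonglongrightarrow> 0 + 0"
      by (intro tendsto_add g(2) lim')
    then have "norm2 (g - g') \<le> 0 + 0"
      by (rule LIMSEQ_le_const) (simp add: le)
    then have "norm2 (g - g') = 0" using norm2_nonneg[of "g - g'"] by linarith
    then show "g' = g" using norm2_eq_0_iff[OF diff_Lh2[OF g(1) conjunct1[OF P']]] by simp
  qed
  then show "toeplitz u h \<in> Lh2"
    and "\<And>p. (\<And>n. p n \<in> harmonic_polys) \<Longrightarrow> (\<lambda>n. norm2 (p n - h)) \<longlonglongrightarrow> 0 \<Longrightarrow>
      (\<lambda>n. norm2 (?S (p n) - toeplitz u h)) \<longlonglongrightarrow> 0"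
    by blast+
qed

text \<open>For truncated series \<open>p\<close> and \<open>q\<close> both sides are the integral of \<open>u p q\<close>; the general case follows by
  continuity of the form.\<close>

lemma toeplitz_symmetric:
  assumes u: "T_function u" and g: "g \<in> Lh2" and h: "h \<in> Lh2"
  shows "bilin (toeplitz u g) h = bilin g (toeplitz u h)"
proof -
  let ?S = "\<lambda>p. Q (\<lambda>w. u w * p w)"
  have ui: "integrable dA u" using u by (simp add: T_function_def)
  have S: "\<And>p. p \<in> harmonic_polys \<Longrightarrow> ?S p \<in> Lh2" using T_function_bound[OF u] by metis
  obtain a b where sg: "harm_series g a b" using Lh2_series[OF g] .
  obtain c d where sh: "harm_series h c d" using Lh2_series[OF h] .
  have b0: "b 0 = 0" and d0: "d 0 = 0" using sg sh by (auto simp: harm_series_def)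
  define p q where "p n = disc_poly a b n" and "q n = disc_poly c d n" for n
  have p: "p n \<in> harmonic_polys" and q: "q n \<in> harmonic_polys" for n
    unfolding p_def q_def using disc_poly_harmonic_polys[of b, OF b0] disc_poly_harmonic_polys[of d, OF d0] by auto
  note pL = harmonic_polys_Lh2[OF p] and qL = harmonic_polys_Lh2[OF q]
  have p_lim: "(\<lambda>n. norm2 (p n - g)) \<longlonglongrightarrow> 0" and q_lim: "(\<lambda>n. norm2 (q n - h)) \<longlonglongrightarrow> 0"
    unfolding p_def q_def using disc_poly_tendsto[OF g sg] disc_poly_tendsto[OF h sh] by auto
  have eq: "bilin (?S (p n)) (q n) = bilin (p n) (?S (q n))" for n
  proof -
    have "bilin (?S (p n)) (q n) = bilin (\<lambda>w. u w * p n w) (q n)"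
      unfolding q_def by (rule bilin_Q_disc_poly[OF integrable_times_harmonic_poly[OF ui p] S[OF p], of d, OF d0])
    also have "\<dots> = bilin (\<lambda>w. u w * q n w) (p n)"
      by (simp add: bilin_def mult_ac)
    also have "\<dots> = bilin (?S (q n)) (p n)"
      unfolding p_def by (rule bilin_Q_disc_poly[OF integrable_times_harmonic_poly[OF ui q] S[OF q], of b, OF b0, symmetric])
    finally show ?thesis by (simp only: bilin_commute)
  qed
  have "(\<lambda>n. bilin (?S (p n)) (q n)) \<longlonglongrightarrow> bilin (toeplitz u g) h"
    by (rule bilin_tendsto[OF S[OF p] toeplitz_works(1)[OF u g] toeplitz_works(2)[OF u g p p_lim] qL h q_lim])
  moreover have "(\<lambda>n. bilin (p n) (?S (q n))) \<longlonglongrightarrow> bilin g (toeplitz u h)"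
    by (rule bilin_tendsto[OF pL g p_lim S[OF q] toeplitz_works(1)[OF u h] toeplitz_works(2)[OF u h q q_lim]])
  ultimately show ?thesis unfolding eq by (rule LIMSEQ_unique)
qed


section \<open>Transposes of operators of finite rank\<close>

lemma zero_in_Lh2: "0 \<in> Lh2"
  using zero_Lh2 by (simp add: zero_fun_def)

lemma subspace_Lh2: "cfun.subspace Lh2"
  by (simp add: cfun.subspace_def zero_in_Lh2 add_Lh2 scale_Lh2)

lemma span_subset_Lh2: "W \<subseteq> Lh2 \<Longrightarrow> cfun.span W \<subseteq> Lh2"
  by (rule cfun.span_minimal[OF _ subspace_Lh2])

lemma bilin_add_right:
  assumes "g \<in> Lh2" "h \<in> Lh2" "k \<in> Lh2"
  shows "bilin k (g + h) = bilin k g + bilin k h"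
  using bilin_lincomb_left[OF assms, of 1] by (simp add: bilin_commute[of k] plus_fun_def)

lemma bilin_scale_right: "bilin k (\<lambda>z. c * h z) = c * bilin k h"
proof -
  have "bilin k (\<lambda>z. c * h z) = (LINT z|dA. c * (k z * h z))"
    unfolding bilin_def by (intro Bochner_Integration.integral_cong refl) simp
  then show ?thesis by (simp add: bilin_def)
qed

lemma bilin_zero_right [simp]: "bilin k 0 = 0"
  by (simp add: bilin_def)

lemma subspace_annihilator: "k \<in> Lh2 \<Longrightarrow> cfun.subspace {f \<in> Lh2. bilin k f = 0}"
  by (simp add: cfun.subspace_def zero_in_Lh2 add_Lh2 scale_Lh2 bilin_add_right bilin_scale_right)

lemma bilin_zero_on_span:
  assumes "k \<in> Lh2" "W \<subseteq> Lh2" "\<And>w. w \<in> W \<Longrightarrow> bilin k w = 0" "f \<in> cfun.span W"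
  shows "bilin k f = 0"
proof -
  have "cfun.span W \<subseteq> {f \<in> Lh2. bilin k f = 0}"
    by (rule cfun.span_minimal[OF _ subspace_annihilator[OF assms(1)]]) (use assms in auto)
  then show ?thesis using assms(4) by blast
qed

text \<open>It suffices to test with the complex conjugate of \<open>k\<close>, which lies in \<open>Lh2\<close>.\<close>

lemma bilin_nondegenerate:
  assumes k: "k \<in> Lh2" and zero: "\<And>g. g \<in> Lh2 \<Longrightarrow> bilin g k = 0"
  shows "k = 0"
proof -
  have "ip k k = 0" unfolding ip_eq_bilin using zero[OF cnj_Lh2[OF k]] by (simp add: bilin_commute)
  then have "norm2 k = 0" by (simp add: ip_self)
  then show ?thesis using norm2_eq_0_iff[OF k] by simp
qed

text \<open>The common kernel of finitely many functionals \<open>bilin b\<close> has codimension at most their number. By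
  induction: a further functional either vanishes on the kernel obtained so far, or the kernel
  contains some \<open>k\<close> on which it does not, and then \<open>k\<close> spans what is cut off.\<close>

lemma annihilator_complement:
  assumes "finite B" "B \<subseteq> Lh2"
  shows "\<exists>H. finite H \<and> card H \<le> card B \<and> H \<subseteq> Lh2 \<and>
    (\<forall>h\<in>Lh2. \<exists>s\<in>cfun.span H. \<forall>b\<in>B. bilin b (h - s) = 0)"
  using assms
proof (induction B rule: finite_induct)
  case empty
  then show ?case by (intro exI[of _ "{}"]) simp
next
  case (insert b B)
  have bL: "b \<in> Lh2" and BL: "B \<subseteq> Lh2" using insert.prems by auto
  obtain H where H: "finite H" "card H \<le> card B" "H \<subseteq> Lh2"
    "\<And>h. h \<in> Lh2 \<Longrightarrow> \<exists>s\<in>cfun.span H. \<forall>b\<in>B. bilin b (h - s) = 0"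
    using insert.IH[OF BL] by blast
  show ?case
  proof (cases "\<exists>k\<in>Lh2. (\<forall>b\<in>B. bilin b k = 0) \<and> bilin b k \<noteq> 0")
    case False
    have "\<exists>s\<in>cfun.span H. \<forall>b\<in>insert b B. bilin b (h - s) = 0" if h: "h \<in> Lh2" for h
    proof -
      obtain s where s: "s \<in> cfun.span H" "\<forall>b\<in>B. bilin b (h - s) = 0" using H(4)[OF h] by blast
      have "h - s \<in> Lh2" using s(1) span_subset_Lh2[OF H(3)] h by (intro diff_Lh2) auto
      then have "bilin b (h - s) = 0" using False s(2) by blast
      then show ?thesis using s by blast
    qed
    moreover have "card H \<le> card (insert b B)" using H(2) insert.hyps by simp
    ultimately show ?thesis using H(1,3) by blast
  next
    case True
    then obtain k where k: "k \<in> Lh2" "\<forall>b\<in>B. bilin b k = 0" "bilin b k \<noteq> 0" by blast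
    have "\<exists>s\<in>cfun.span (insert k H). \<forall>b\<in>insert b B. bilin b (h - s) = 0" if h: "h \<in> Lh2" for h
    proof -
      obtain s where s: "s \<in> cfun.span H" "\<forall>b\<in>B. bilin b (h - s) = 0" using H(4)[OF h] by blast
      have sL: "s \<in> Lh2" using s(1) span_subset_Lh2[OF H(3)] by blast
      define t where "t = bilin b (h - s) / bilin b k"
      define s' where "s' = s + (\<lambda>z. t * k z)"
      have split: "bilin b' (h - s') = bilin b' (h - s) - t * bilin b' k" if "b' \<in> Lh2" for b'
      proof -
        have eq: "h - s' = (h - s) - (\<lambda>z. t * k z)" unfolding s'_def by (rule diff_diff_eq[symmetric])
        show ?thesis
          unfolding eq bilin_diff_right[OF diff_Lh2[OF h sL] scale_Lh2[OF k(1), of t] that]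
          by (simp only: bilin_scale_right)
      qed
      have "s \<in> cfun.span (insert k H)" using s(1) cfun.span_mono[of H "insert k H"] by blast
      moreover have "(\<lambda>z. t * k z) \<in> cfun.span (insert k H)" by (rule cfun.span_scale[OF cfun.span_base]) simp
      ultimately have "s' \<in> cfun.span (insert k H)" unfolding s'_def by (rule cfun.span_add)
      moreover have "\<forall>b'\<in>insert b B. bilin b' (h - s') = 0"
      proof
        fix b' assume b': "b' \<in> insert b B"
        then have "b' \<in> Lh2" using bL BL by auto
        then show "bilin b' (h - s') = 0"
          using b' s(2) k(2,3) by (auto simp: split t_def)
      qed
      ultimately show ?thesis by blast
    qed
    moreover have "card (insert k H) \<le> card (insert b B)"
      using H(1,2) insert.hyps by (simp add: card_insert_if)
    moreover have "finite (insert k H)" "insert k H \<subseteq> Lh2" using H(1,3) k(1) by auto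
    ultimately show ?thesis by blast
  qed
qed

text \<open>The transpose \<open>A'\<close> vanishes on the annihilator of the range of \<open>A\<close>, so its range is the image of a
  complement, which has dimension at most \<open>card B\<close>. Linearity of \<open>A'\<close> comes for free from the
  adjunction and nondegeneracy.\<close>

lemma range_adjoint_finite_dim:
  assumes A: "\<And>h. h \<in> Lh2 \<Longrightarrow> A h \<in> Lh2" and A': "\<And>h. h \<in> Lh2 \<Longrightarrow> A' h \<in> Lh2"
    and adj: "\<And>g h. g \<in> Lh2 \<Longrightarrow> h \<in> Lh2 \<Longrightarrow> bilin (A g) h = bilin g (A' h)"
    and B: "finite B" "B \<subseteq> Lh2" "A ` Lh2 \<subseteq> cfun.span B"
  shows "\<exists>W. finite W \<and> card W \<le> card B \<and> W \<subseteq> Lh2 \<and> A' ` Lh2 \<subseteq> cfun.span W"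
proof -
  obtain H where H: "finite H" "card H \<le> card B" "H \<subseteq> Lh2"
    "\<And>h. h \<in> Lh2 \<Longrightarrow> \<exists>s\<in>cfun.span H. \<forall>b\<in>B. bilin b (h - s) = 0"
    using annihilator_complement[OF B(1,2)] by blast
  have eq_if: "k = k'" if "k \<in> Lh2" "k' \<in> Lh2" "\<And>g. g \<in> Lh2 \<Longrightarrow> bilin g k = bilin g k'" for k k'
    using bilin_nondegenerate[of "k - k'"] that by (simp add: diff_Lh2 bilin_diff_right)
  have add: "A' (h + k) = A' h + A' k" if "h \<in> Lh2" "k \<in> Lh2" for h k
    by (rule eq_if) (simp_all add: that add_Lh2 A A' bilin_add_right flip: adj)
  have scale: "A' (\<lambda>z. c * h z) = (\<lambda>z. c * A' h z)" if "h \<in> Lh2" for c h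
    by (rule eq_if) (simp_all add: that scale_Lh2 A A' bilin_scale_right flip: adj)
  have zero: "A' 0 = 0"
    by (rule eq_if) (simp_all add: zero_in_Lh2 A' flip: adj)
  have "cfun.subspace {s \<in> Lh2. A' s \<in> cfun.span (A' ` H)}"
    unfolding cfun.subspace_def
    by (auto simp: zero_in_Lh2 zero add scale add_Lh2 scale_Lh2 intro: cfun.span_zero cfun.span_add cfun.span_scale)
  then have span: "cfun.span H \<subseteq> {s \<in> Lh2. A' s \<in> cfun.span (A' ` H)}"
    using H(3) by (intro cfun.span_minimal) (auto intro: cfun.span_base)
  have kernel: "A' k = 0" if k: "k \<in> Lh2" and ann: "\<forall>b\<in>B. bilin b k = 0" for k
  proof (rule bilin_nondegenerate[OF A'[OF k]])
    fix g assume g: "g \<in> Lh2"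
    have "bilin k (A g) = 0"
    proof (rule bilin_zero_on_span[OF k B(2)])
      show "bilin k b = 0" if "b \<in> B" for b using ann that by (simp only: bilin_commute[of k])
      show "A g \<in> cfun.span B" using B(3) g by blast
    qed
    then show "bilin g (A' k) = 0" using adj[OF g k] by (simp only: bilin_commute[of k])
  qed
  have "A' h \<in> cfun.span (A' ` H)" if h: "h \<in> Lh2" for h
  proof -
    obtain s where s: "s \<in> cfun.span H" "\<forall>b\<in>B. bilin b (h - s) = 0" using H(4)[OF h] by blast
    have sL: "s \<in> Lh2" "A' s \<in> cfun.span (A' ` H)" using s(1) span by auto
    have "A' h = A' (s + (h - s))" by simp
    also have "\<dots> = A' s + A' (h - s)" by (rule add[OF sL(1) diff_Lh2[OF h sL(1)]])
    also have "\<dots> = A' s" using kernel[OF diff_Lh2[OF h sL(1)] s(2)] by simp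
    finally show ?thesis using sL(2) by simp
  qed
  then show ?thesis
    using H(1,2,3) A' card_image_le[OF H(1), of A'] by (intro exI[of _ "A' ` H"]) auto
qed

section \<open>Closedness of finite-dimensional subspaces\<close>

lemma ip_scale_left: "ip (\<lambda>z. c * g z) h = c * ip g h"
  unfolding ip_eq_bilin bilin_commute[of _ "\<lambda>z. cnj (h z)"] by (rule bilin_scale_right)

lemma ip_diff_left:
  assumes "g \<in> Lh2" "h \<in> Lh2" "k \<in> Lh2"
  shows "ip (g - h) k = ip g k - ip h k"
  unfolding ip_eq_bilin by (rule bilin_diff_left[OF assms(1,2) cnj_Lh2[OF assms(3)]])

lemma ip_cnj_commute: "ip h g = cnj (ip g h)"
  unfolding ip_def Bochner_Integration.integral_cnj[symmetric] by (simp add: mult.commute)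

lemma ip_zero_on_span:
  assumes k: "k \<in> Lh2" and W: "W \<subseteq> Lh2" "\<And>w. w \<in> W \<Longrightarrow> ip k w = 0" and f: "f \<in> cfun.span W"
  shows "ip k f = 0"
proof -
  have "bilin (\<lambda>z. cnj (k z)) f = 0"
    using W(2) by (intro bilin_zero_on_span[OF cnj_Lh2[OF k] W(1) _ f])
      (simp add: bilin_commute[of "\<lambda>z. cnj (k z)"] ip_cnj_commute[of _ k] flip: ip_eq_bilin)
  then have "ip f k = 0" by (simp add: ip_eq_bilin bilin_commute)
  then show ?thesis by (simp add: ip_cnj_commute[of k])
qed

text \<open>The Gram--Schmidt step: the new vector \<open>w\<close> is replaced by its component \<open>e\<close> orthogonal to the span of
  \<open>W\<close>. If \<open>e = 0\<close>, division by \<open>0\<close> gives the correct correction \<open>t = 0\<close>.\<close>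

lemma orthogonal_projection_exists:
  assumes "finite W" "W \<subseteq> Lh2" "g \<in> Lh2"
  shows "\<exists>p\<in>cfun.span W. \<forall>w\<in>W. ip (g - p) w = 0"
  using assms
proof (induction W arbitrary: g rule: finite_induct)
  case empty
  then show ?case by (intro bexI[of _ 0]) (auto simp: cfun.span_zero)
next
  case (insert w W)
  have wL: "w \<in> Lh2" and WL: "W \<subseteq> Lh2" using insert.prems by auto
  obtain q where q: "q \<in> cfun.span W" "\<forall>v\<in>W. ip (w - q) v = 0" using insert.IH[OF WL wL] by blast
  obtain p where p: "p \<in> cfun.span W" "\<forall>v\<in>W. ip (g - p) v = 0" using insert.IH[OF WL insert.prems(2)] by blast
  have qL: "q \<in> Lh2" and pL: "p \<in> Lh2" using p q span_subset_Lh2[OF WL] by auto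
  define e where "e = w - q"
  define t where "t = ip (g - p) e / ip e e"
  define p' where "p' = p + (\<lambda>z. t * e z)"
  have eL: "e \<in> Lh2" unfolding e_def by (rule diff_Lh2[OF wL qL])
  have gpL: "g - p \<in> Lh2" by (rule diff_Lh2[OF insert.prems(2) pL])
  have mono: "cfun.span W \<subseteq> cfun.span (insert w W)" by (rule cfun.span_mono) auto
  have "e \<in> cfun.span (insert w W)"
    unfolding e_def using q(1) mono by (intro cfun.span_diff) (auto intro: cfun.span_base)
  then have p'_span: "p' \<in> cfun.span (insert w W)"
    unfolding p'_def using p(1) mono by (intro cfun.span_add cfun.span_scale) auto
  have p'L: "p' \<in> Lh2" using p'_span span_subset_Lh2[OF insert.prems(1)] by blast
  have split: "ip (g - p') v = ip (g - p) v - t * ip e v" if "v \<in> Lh2" for v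
  proof -
    have eq: "g - p' = (g - p) - (\<lambda>z. t * e z)" unfolding p'_def by (rule diff_diff_eq[symmetric])
    show ?thesis
      unfolding eq ip_diff_left[OF gpL scale_Lh2[OF eL, of t] that] by (simp only: ip_scale_left)
  qed
  have orthW: "ip (g - p') v = 0" if "v \<in> W" for v
    using split[of v] that WL p(2) q(2) by (auto simp: e_def)
  have orthe: "ip (g - p') e = 0"
  proof (cases "ip e e = 0")
    case True
    then have "e = 0" using norm2_eq_0_iff[OF eL] by (simp add: ip_self)
    then show ?thesis by (simp add: ip_def)
  qed (simp add: split[OF eL] t_def)
  have "ip (g - p') q = 0"
    by (rule ip_zero_on_span[OF diff_Lh2[OF insert.prems(2) p'L] WL orthW q(1)])
  then have "ip q (g - p') = 0" by (simp add: ip_cnj_commute[of q])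
  moreover have "ip e (g - p') = 0" using orthe by (simp add: ip_cnj_commute[of e])
  ultimately have "ip w (g - p') = 0"
    using ip_diff_left[OF wL qL diff_Lh2[OF insert.prems(2) p'L]] by (simp add: e_def)
  then have "ip (g - p') w = 0" by (simp add: ip_cnj_commute[of _ w])
  then show ?case using p'_span orthW by blast
qed

text \<open>The orthogonal projection \<open>p\<close> of \<open>g\<close> is the nearest point of the subspace, so an approximable \<open>g\<close> is at
  distance \<open>0\<close> from it.\<close>

lemma finite_dim_closed:
  assumes W: "finite W" "W \<subseteq> Lh2" and g: "g \<in> Lh2"
    and approx: "\<And>e. e > 0 \<Longrightarrow> \<exists>h\<in>cfun.span W. norm2 (h - g) < e"
  shows "g \<in> cfun.span W"
proof -
  obtain p where p: "p \<in> cfun.span W" "\<forall>w\<in>W. ip (g - p) w = 0"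
    using orthogonal_projection_exists[OF W g] by blast
  define x where "x = g - p"
  have pL: "p \<in> Lh2" using p(1) span_subset_Lh2[OF W(2)] by blast
  have xL: "x \<in> Lh2" unfolding x_def by (rule diff_Lh2[OF g pL])
  have le: "norm2 x \<le> norm2 (h - g)" if h: "h \<in> cfun.span W" for h
  proof -
    have hL: "h \<in> Lh2" using h span_subset_Lh2[OF W(2)] by blast
    have "ip x (h - p) = 0"
      using p(2) by (intro ip_zero_on_span[OF xL W(2) _ cfun.span_diff[OF h p(1)]]) (simp add: x_def)
    then have "ip (h - p) x = 0" by (simp add: ip_cnj_commute[of _ x])
    moreover have "x = (h - p) - (h - g)" by (simp add: x_def)
    ultimately have "ip x x = - ip (h - g) x"
      using ip_diff_left[OF diff_Lh2[OF hL pL] diff_Lh2[OF hL g] xL] by simp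
    then have "cmod (ip x x) = cmod (ip (h - g) x)" by simp
    also have "\<dots> \<le> norm2 (h - g) * norm2 x"
      unfolding ip_eq_bilin using bilin_Cauchy_Schwarz[OF diff_Lh2[OF hL g] cnj_Lh2[OF xL]] by (simp add: norm2_cnj)
    finally have "norm2 x * norm2 x \<le> norm2 (h - g) * norm2 x"
      by (simp add: ip_self norm_mult power2_eq_square)
    then show ?thesis
      using norm2_nonneg[of x] by (cases "norm2 x = 0") auto
  qed
  have "norm2 x = 0"
  proof (rule ccontr)
    assume "norm2 x \<noteq> 0"
    then have "norm2 x > 0" using norm2_nonneg[of x] by linarith
    then show False using approx[of "norm2 x"] le by fastforce
  qed
  then have "g = p" using norm2_eq_0_iff[OF xL] by (simp add: x_def)
  then show ?thesis using p(1) by simp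
qed

lemma subset_Lh2_closure: "X \<subseteq> Lh2 \<Longrightarrow> X \<subseteq> Lh2_closure X"
  unfolding Lh2_closure_def by (auto intro!: bexI simp: norm2_def)

section \<open>The commutator\<close>

theorem corollary2p3:
  fixes f1 f2 f :: "complex \<Rightarrow> complex" and N :: nat
  assumes "T_function f1" and "T_function f2" and "T_function f"
    and "finite_rank (\<lambda>h. toeplitz f1 (toeplitz f2 h) - toeplitz f h)"
    and "op_rank (\<lambda>h. toeplitz f1 (toeplitz f2 h) - toeplitz f h) = N"
  shows "finite_rank (\<lambda>h. toeplitz f1 (toeplitz f2 h) - toeplitz f2 (toeplitz f1 h)) \<and>
    op_rank (\<lambda>h. toeplitz f1 (toeplitz f2 h) - toeplitz f2 (toeplitz f1 h)) \<le> 2 * N"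
proof -
  define A where "A h = toeplitz f1 (toeplitz f2 h) - toeplitz f h" for h
  define A' where "A' h = toeplitz f2 (toeplitz f1 h) - toeplitz f h" for h
  define D where "D h = toeplitz f1 (toeplitz f2 h) - toeplitz f2 (toeplitz f1 h)" for h
  note T = toeplitz_works(1)[OF assms(1)] toeplitz_works(1)[OF assms(2)] toeplitz_works(1)[OF assms(3)]
  have AL: "A h \<in> Lh2" and A'L: "A' h \<in> Lh2" if "h \<in> Lh2" for h
    unfolding A_def A'_def using that by (auto intro!: diff_Lh2 T)
  have adj: "bilin (A g) h = bilin g (A' h)" if g: "g \<in> Lh2" and h: "h \<in> Lh2" for g h
  proof -
    have "bilin (A g) h = bilin (toeplitz f1 (toeplitz f2 g)) h - bilin (toeplitz f g) h"
      unfolding A_def by (intro bilin_diff_left T g h)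
    also have "\<dots> = bilin g (toeplitz f2 (toeplitz f1 h)) - bilin g (toeplitz f h)"
      by (simp add: toeplitz_symmetric[OF assms(1)] toeplitz_symmetric[OF assms(2)] toeplitz_symmetric[OF assms(3)] T g h)
    also have "\<dots> = bilin g (A' h)"
      unfolding A'_def by (intro bilin_diff_right[symmetric] T g h)
    finally show ?thesis .
  qed
  obtain B0 where B0: "finite B0" "Lh2_closure (A ` Lh2) \<subseteq> cfun.span B0"
    using assms(4) unfolding finite_rank_def A_def by blast
  have "A ` Lh2 \<subseteq> Lh2" using AL by auto
  then have A_B0: "A ` Lh2 \<subseteq> cfun.span B0" using subset_Lh2_closure B0(2) by blast
  obtain B where B: "B \<subseteq> A ` Lh2" "cfun.independent B" "A ` Lh2 \<subseteq> cfun.span B" "card B = cfun.dim (A ` Lh2)"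
    by (rule cfun.basis_exists)
  have finB: "finite B"
    using cfun.independent_span_bound[OF B0(1) B(2)] B(1) A_B0 by blast
  have cardB: "card B = N" using B(4) assms(5) by (simp add: op_rank_def A_def)
  have BL: "B \<subseteq> Lh2" using B(1) AL by auto
  obtain W where W: "finite W" "card W \<le> N" "W \<subseteq> Lh2" "A' ` Lh2 \<subseteq> cfun.span W"
    using range_adjoint_finite_dim[of A A', OF AL A'L adj finB BL B(3)] cardB by auto
  have D_span: "D ` Lh2 \<subseteq> cfun.span (B \<union> W)"
  proof safe
    fix h assume h: "h \<in> Lh2"
    have "A h \<in> cfun.span (B \<union> W)" "A' h \<in> cfun.span (B \<union> W)"
      using h B(3) W(4) cfun.span_mono[of B "B \<union> W"] cfun.span_mono[of W "B \<union> W"] by auto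
    then have "A h - A' h \<in> cfun.span (B \<union> W)" by (rule cfun.span_diff)
    then show "D h \<in> cfun.span (B \<union> W)" by (simp add: A_def A'_def D_def)
  qed
  have fin: "finite (B \<union> W)" and sub: "B \<union> W \<subseteq> Lh2" using finB W BL by auto
  have "Lh2_closure (D ` Lh2) \<subseteq> cfun.span (B \<union> W)"
  proof
    fix g assume g: "g \<in> Lh2_closure (D ` Lh2)"
    show "g \<in> cfun.span (B \<union> W)"
    proof (rule finite_dim_closed[OF fin sub])
      show "g \<in> Lh2" using g by (simp add: Lh2_closure_def)
      show "\<exists>h\<in>cfun.span (B \<union> W). norm2 (h - g) < e" if "e > 0" for e
        using g that D_span unfolding Lh2_closure_def by blast
    qed
  qed
  then have "finite_rank D" unfolding finite_rank_def using fin by blast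
  moreover have "op_rank D \<le> 2 * N"
  proof -
    have "op_rank D \<le> card (B \<union> W)" unfolding op_rank_def by (rule cfun.dim_le_card[OF D_span fin])
    also have "\<dots> \<le> card B + card W" by (rule card_Un_le)
    also have "\<dots> \<le> 2 * N" using cardB W(2) by simp
    finally show ?thesis .
  qed
  ultimately show ?thesis unfolding D_def by simp
qed


end
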